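(* Let $\theta_1$ and $\theta_2$ be substitutions that are arity type compatible relative to an arity context $\Theta$, and let $\Theta'=\mathrm{ctx}(\theta_2\circ\theta_1)\oplus\Theta$. (1) If $E$ is a canonical kind, type or context that respects $\Theta'$ and $E',E''$ are such that $[\theta_1]E=E'$ and $[\theta_2]E'=E''$ are derivable, then $[\theta_2\circ\theta_1]E=E''$ is derivable. (2) If $M$ is a canonical term such that $\Theta'\vdash M:\alpha$ is derivable for some arity type $\alpha$, and $M',M''$ are canonical terms such that $[\theta_1]M=M'$ and $[\theta_2]M'=M''$ are derivable, then $[\theta_2\circ\theta_1]M=M''$ is derivable. (3) If $R$ is an atomic term such that $\Theta'\vdash R\Rightarrow\alpha$ is derivable for some arity type $\alpha$, then: (a) if $M',M''$ are canonical terms such that $[\theta_1]_rR=M':\alpha$ and $[\theta_2]M'=M''$ are derivable, then $[\theta_2\circ\theta_1]_rR=M'':\alpha$ is derivable; (b) if $R'$ is atomic and $M''$ canonical such that $[\theta_1]_rR=R'$ and $[\theta_2]_rR'=M'':\alpha$ are derivable, then $[\theta_2\circ\theta_1]_rR=M'':\alpha$ is derivable; (c) if $R',R''$ are atomic terms such that $[\theta_1]_rR=R'$ and $[\theta_2]_rR'=R''$ are derivable, then $[\theta_2\circ\theta_1]_rR=R''$ is derivable.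
   Context: Canonical LF syntax: kinds $K ::= \mathrm{Type} \mid \Pi x{:}A.K$; canonical types $A ::= P \mid \Pi x{:}A.B$; atomic types $P ::= a \mid P\,M$; canonical terms $M ::= R \mid \lambda x.M$; atomic terms $R ::= c \mid x \mid R\,M$; contexts $\Gamma ::= \cdot\mid\Gamma,x{:}A$ (up to renaming of bound variables). Arity types are generated from $o$ by $\rightarrow$; erasure: $P^-=o$, $(\Pi x{:}A_1.A_2)^-=A_1^-\rightarrow A_2^-$. A substitution is a finite set of triples $\langle x,M,\alpha\rangle$ with distinct variables $x$, canonical $M$, arity type $\alpha$; $\mathrm{ctx}(\theta)=\{x:\alpha\mid\langle x,M,\alpha\rangle\in\theta\}$. Arity contexts $\Theta$: sets of unique assignments of arity types to constants and variables; $\Theta_1\oplus\Theta_2$ is $\Theta_1$ together with the assignments of $\Theta_2$ to symbols not assigned in $\Theta_1$. Arity typing: $\Theta\vdash c\Rightarrow\alpha$ / $\Theta\vdash x\Rightarrow\alpha$ if the symbol is assigned $\alpha$; $\Theta\vdash R\,M\Rightarrow\alpha$ if $\Theta\vdash R\Rightarrow\alpha'\rightarrow\alpha$ and $\Theta\vdash M:\alpha'$; $\Theta\vdash\lambda x.M:\alpha_1\rightarrow\alpha_2$ if $\{x:\alpha_1\}\oplus\Theta\vdash M:\alpha_2$; $\Theta\vdash R:o$ if $\Theta\vdash R\Rightarrow o$. A kind or type respects $\Theta$ if it is $\mathrm{Type}$, or it is atomic and every canonical term in it has some arity type under $\Theta$, or it is $\Pi x{:}A.E'$ with $A$ respecting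 $\Theta$ and $E'$ respecting $\{x:A^-\}\oplus\Theta$; a context respects $\Theta$ if each type in it does. $\theta$ is arity type preserving w.r.t. $\Theta$ if $\Theta\vdash M:\alpha$ for every $\langle x,M,\alpha\rangle\in\theta$. $\theta_1,\theta_2$ are arity type compatible relative to $\Theta$ if $\theta_2$ is arity type preserving w.r.t. $\Theta$ and $\theta_1$ is arity type preserving w.r.t. $\mathrm{ctx}(\theta_2)\oplus\Theta$. Their composition is $\theta_2\circ\theta_1=\{\langle x,M',\alpha\rangle\mid\langle x,M,\alpha\rangle\in\theta_1,\ [\theta_2]M=M'\}\cup\{\langle y,N,\beta\rangle\in\theta_2\mid y\notin\mathrm{dom}(\theta_1)\}$ (well defined: such $M'$ exists and is unique). Hereditary substitution is the least relation closed under: $[\theta]R=R'$ if $[\theta]_rR=R'$; $[\theta]R=M'$ if $[\theta]_rR=M':\alpha'$; $[\theta](\lambda x.M)=\lambda x.M'$ if $x\notin\mathrm{dom}(\theta)$, $x$ not free in $\mathrm{rng}(\theta)$, $[\theta]M=M'$; $[\theta]_rx=M:\alpha$ if $\langle x,M,\alpha\rangle\in\theta$; $[\theta]_r(R\,M)=M''':\alpha''$ if $[\theta]_rR=\lambda x.M':\alpha'\rightarrow\alpha''$, $[\theta]M=M''$, $[\{\langle x,M'',\alpha'\rangle\}]M'=M'''$; $[\theta]_rc=c$; $[\theta]_rx=x$ if $x\notin\mathrm{dom}(\theta)$; $[\theta]_r(R\,M)=R'\,M'$ if $[\theta]_rR=R'$, $[\theta]M=M'$; for types $[\theta]a=a$,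 $[\theta](P\,M)=P'\,M'$, and $[\theta](\Pi x{:}A_1.A_2)=\Pi x{:}A_1'.A_2'$ componentwise with $x$ fresh for $\theta$; for kinds analogously with $[\theta]\mathrm{Type}=\mathrm{Type}$; for contexts $[\theta]\cdot=\cdot$ and $[\theta](\Gamma,x{:}A)=\Gamma',x{:}A'$ if $x$ fresh for $\theta$, $[\theta]\Gamma=\Gamma'$, $[\theta]A=A'$. *)

theory Defs
  imports Main
begin

text \<open>
  Expressions up to renaming of bound variables are represented in locally nameless style: free
  variables carry names, bound occurrences are de Bruijn indices, and the binders of the paper
  are the functions \<open>lam\<close>, \<open>tpi\<close>, \<open>kpi\<close> below, which turn the name \<open>x\<close> into the index of a new
  outermost binder.  Thus \<open>lam x M\<close> is the alpha-equivalence class of the abstraction of \<open>x\<close> over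
  \<open>M\<close>, and all rules are stated through it.  Raw expressions with a dangling \<open>Bound\<close> do
  not represent anything; no typing, respectfulness or substitution rule has a conclusion for
  \<open>Bound\<close>, so they satisfy none of these judgements (see the lemmas \<open>lc_*\<close>).
\<close>

type_synonym var = nat

datatype 'c cterm = Atm "'c aterm" | Lam "'c cterm"
  and 'c aterm = Const 'c | Free var | Bound nat | App "'c aterm" "'c cterm"

datatype ('a, 'c) atype = TConst 'a | TApp "('a, 'c) atype" "'c cterm"

datatype ('a, 'c) ctype = TAtm "('a, 'c) atype" | TPi "('a, 'c) ctype" "('a, 'c) ctype"

datatype ('a, 'c) kind = KType | KPi "('a, 'c) ctype" "('a, 'c) kind"

text \<open>The variables declared in a context keep their names.\<close>

datatype ('a, 'c) lfctx = Empty | Extend "('a, 'c) lfctx" var "('a, 'c) ctype"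

primrec close_cterm :: "nat \<Rightarrow> var \<Rightarrow> 'c cterm \<Rightarrow> 'c cterm"
  and close_aterm :: "nat \<Rightarrow> var \<Rightarrow> 'c aterm \<Rightarrow> 'c aterm" where
  "close_cterm k x (Atm R) = Atm (close_aterm k x R)"
| "close_cterm k x (Lam M) = Lam (close_cterm (Suc k) x M)"
| "close_aterm k x (Const c) = Const c"
| "close_aterm k x (Free y) = (if y = x then Bound k else Free y)"
| "close_aterm k x (Bound i) = Bound i"
| "close_aterm k x (App R M) = App (close_aterm k x R) (close_cterm k x M)"

primrec close_atype :: "nat \<Rightarrow> var \<Rightarrow> ('a, 'c) atype \<Rightarrow> ('a, 'c) atype" where
  "close_atype k x (TConst a) = TConst a"
| "close_atype k x (TApp P M) = TApp (close_atype k x P) (close_cterm k x M)"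

primrec close_ctype :: "nat \<Rightarrow> var \<Rightarrow> ('a, 'c) ctype \<Rightarrow> ('a, 'c) ctype" where
  "close_ctype k x (TAtm P) = TAtm (close_atype k x P)"
| "close_ctype k x (TPi A B) = TPi (close_ctype k x A) (close_ctype (Suc k) x B)"

primrec close_kind :: "nat \<Rightarrow> var \<Rightarrow> ('a, 'c) kind \<Rightarrow> ('a, 'c) kind" where
  "close_kind k x KType = KType"
| "close_kind k x (KPi A K) = KPi (close_ctype k x A) (close_kind (Suc k) x K)"

definition lam :: "var \<Rightarrow> 'c cterm \<Rightarrow> 'c cterm" where
  "lam x M = Lam (close_cterm 0 x M)"

definition tpi :: "var \<Rightarrow> ('a, 'c) ctype \<Rightarrow> ('a, 'c) ctype \<Rightarrow> ('a, 'c) ctype" where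
  "tpi x A B = TPi A (close_ctype 0 x B)"

definition kpi :: "var \<Rightarrow> ('a, 'c) ctype \<Rightarrow> ('a, 'c) kind \<Rightarrow> ('a, 'c) kind" where
  "kpi x A K = KPi A (close_kind 0 x K)"

primrec fv_cterm :: "'c cterm \<Rightarrow> var set" and fv_aterm :: "'c aterm \<Rightarrow> var set" where
  "fv_cterm (Atm R) = fv_aterm R"
| "fv_cterm (Lam M) = fv_cterm M"
| "fv_aterm (Const c) = {}"
| "fv_aterm (Free x) = {x}"
| "fv_aterm (Bound i) = {}"
| "fv_aterm (App R M) = fv_aterm R \<union> fv_cterm M"

datatype arity = Base (\<open>\<o>\<close>) | Arr arity arity (infixr \<open>\<rightarrow>\<^sub>a\<close> 60)

primrec erase :: "('a, 'c) ctype \<Rightarrow> arity" where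
  "erase (TAtm P) = \<o>"
| "erase (TPi A B) = erase A \<rightarrow>\<^sub>a erase B"

datatype 'c symb = SConst 'c | SVar var

type_synonym 'c actx = "('c symb \<times> arity) set"

definition arity_context :: "'c actx \<Rightarrow> bool" where
  "arity_context \<Theta> \<longleftrightarrow> single_valued \<Theta>"

definition oplus :: "'c actx \<Rightarrow> 'c actx \<Rightarrow> 'c actx" (infixr \<open>\<oplus>\<close> 65) where
  "\<Theta>1 \<oplus> \<Theta>2 = \<Theta>1 \<union> {(s, \<alpha>). (s, \<alpha>) \<in> \<Theta>2 \<and> s \<notin> Domain \<Theta>1}"

inductive synth :: "'c actx \<Rightarrow> 'c aterm \<Rightarrow> arity \<Rightarrow> bool" (\<open>_ \<turnstile> _ \<Rrightarrow> _\<close> [51, 51, 51] 50)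
  and check :: "'c actx \<Rightarrow> 'c cterm \<Rightarrow> arity \<Rightarrow> bool" (\<open>_ \<turnstile> _ :\<^sub>a _\<close> [51, 51, 51] 50) where
  synth_Const: "(SConst c, \<alpha>) \<in> \<Theta> \<Longrightarrow> \<Theta> \<turnstile> Const c \<Rrightarrow> \<alpha>"
| synth_Free: "(SVar x, \<alpha>) \<in> \<Theta> \<Longrightarrow> \<Theta> \<turnstile> Free x \<Rrightarrow> \<alpha>"
| synth_App: "\<Theta> \<turnstile> R \<Rrightarrow> \<alpha>' \<rightarrow>\<^sub>a \<alpha> \<Longrightarrow> \<Theta> \<turnstile> M :\<^sub>a \<alpha>' \<Longrightarrow> \<Theta> \<turnstile> App R M \<Rrightarrow> \<alpha>"
| check_lam: "{(SVar x, \<alpha>1)} \<oplus> \<Theta> \<turnstile> M :\<^sub>a \<alpha>2 \<Longrightarrow> \<Theta> \<turnstile> lam x M :\<^sub>a \<alpha>1 \<rightarrow>\<^sub>a \<alpha>2"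
| check_Atm: "\<Theta> \<turnstile> R \<Rrightarrow> \<o> \<Longrightarrow> \<Theta> \<turnstile> Atm R :\<^sub>a \<o>"

primrec args :: "('a, 'c) atype \<Rightarrow> 'c cterm set" where
  "args (TConst a) = {}"
| "args (TApp P M) = insert M (args P)"

inductive respects_type :: "'c actx \<Rightarrow> ('a, 'c) ctype \<Rightarrow> bool" where
  "(\<And>M. M \<in> args P \<Longrightarrow> \<exists>\<alpha>. \<Theta> \<turnstile> M :\<^sub>a \<alpha>) \<Longrightarrow> respects_type \<Theta> (TAtm P)"
| "respects_type \<Theta> A \<Longrightarrow> respects_type ({(SVar x, erase A)} \<oplus> \<Theta>) B \<Longrightarrow> respects_type \<Theta> (tpi x A B)"

inductive respects_kind :: "'c actx \<Rightarrow> ('a, 'c) kind \<Rightarrow> bool" where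
  "respects_kind \<Theta> KType"
| "respects_type \<Theta> A \<Longrightarrow> respects_kind ({(SVar x, erase A)} \<oplus> \<Theta>) K \<Longrightarrow> respects_kind \<Theta> (kpi x A K)"

primrec respects_ctx :: "'c actx \<Rightarrow> ('a, 'c) lfctx \<Rightarrow> bool" where
  "respects_ctx \<Theta> Empty \<longleftrightarrow> True"
| "respects_ctx \<Theta> (Extend \<Gamma> x A) \<longleftrightarrow> respects_ctx \<Theta> \<Gamma> \<and> respects_type \<Theta> A"

type_synonym 'c subst = "(var \<times> 'c cterm \<times> arity) set"

definition substitution :: "'c subst \<Rightarrow> bool" where
  "substitution \<theta> \<longleftrightarrow> finite \<theta> \<and> single_valued \<theta>"

definition ctx :: "'c subst \<Rightarrow> 'c actx" where
  "ctx \<theta> = {(SVar x, \<alpha>) |x \<alpha>. \<exists>M. (x, M, \<alpha>) \<in> \<theta>}"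

definition fresh_for :: "var \<Rightarrow> 'c subst \<Rightarrow> bool" where
  "fresh_for x \<theta> \<longleftrightarrow> x \<notin> Domain \<theta> \<and> (\<forall>(y, M, \<alpha>) \<in> \<theta>. x \<notin> fv_cterm M)"

text \<open>
  \<open>hsub \<theta> M M'\<close> is \<open>[\<theta>]M = M'\<close>; the two forms of \<open>[\<theta>]\<^sub>r\<close> on atomic terms are
  \<open>hsub_ra \<theta> R R'\<close> for \<open>[\<theta>]\<^sub>r R = R'\<close> and \<open>hsub_rc \<theta> R M \<alpha>\<close> for \<open>[\<theta>]\<^sub>r R = M : \<alpha>\<close>.
\<close>

inductive hsub :: "'c subst \<Rightarrow> 'c cterm \<Rightarrow> 'c cterm \<Rightarrow> bool"
  and hsub_ra :: "'c subst \<Rightarrow> 'c aterm \<Rightarrow> 'c aterm \<Rightarrow> bool"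
  and hsub_rc :: "'c subst \<Rightarrow> 'c aterm \<Rightarrow> 'c cterm \<Rightarrow> arity \<Rightarrow> bool" where
  hsub_ra: "hsub_ra \<theta> R R' \<Longrightarrow> hsub \<theta> (Atm R) (Atm R')"
| hsub_rc: "hsub_rc \<theta> R M' \<alpha>' \<Longrightarrow> hsub \<theta> (Atm R) M'"
| hsub_lam: "fresh_for x \<theta> \<Longrightarrow> hsub \<theta> M M' \<Longrightarrow> hsub \<theta> (lam x M) (lam x M')"
| hsub_rc_Free: "(x, M, \<alpha>) \<in> \<theta> \<Longrightarrow> hsub_rc \<theta> (Free x) M \<alpha>"
| hsub_rc_App: "hsub_rc \<theta> R (lam x M') (\<alpha>' \<rightarrow>\<^sub>a \<alpha>'') \<Longrightarrow> hsub \<theta> M M'' \<Longrightarrow>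
    hsub {(x, M'', \<alpha>')} M' M''' \<Longrightarrow> hsub_rc \<theta> (App R M) M''' \<alpha>''"
| hsub_ra_Const: "hsub_ra \<theta> (Const c) (Const c)"
| hsub_ra_Free: "x \<notin> Domain \<theta> \<Longrightarrow> hsub_ra \<theta> (Free x) (Free x)"
| hsub_ra_App: "hsub_ra \<theta> R R' \<Longrightarrow> hsub \<theta> M M' \<Longrightarrow> hsub_ra \<theta> (App R M) (App R' M')"

inductive hsub_atype :: "'c subst \<Rightarrow> ('a, 'c) atype \<Rightarrow> ('a, 'c) atype \<Rightarrow> bool" where
  "hsub_atype \<theta> (TConst a) (TConst a)"
| "hsub_atype \<theta> P P' \<Longrightarrow> hsub \<theta> M M' \<Longrightarrow> hsub_atype \<theta> (TApp P M) (TApp P' M')"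

inductive hsub_type :: "'c subst \<Rightarrow> ('a, 'c) ctype \<Rightarrow> ('a, 'c) ctype \<Rightarrow> bool" where
  "hsub_atype \<theta> P P' \<Longrightarrow> hsub_type \<theta> (TAtm P) (TAtm P')"
| "fresh_for x \<theta> \<Longrightarrow> hsub_type \<theta> A A' \<Longrightarrow> hsub_type \<theta> B B' \<Longrightarrow>
    hsub_type \<theta> (tpi x A B) (tpi x A' B')"

inductive hsub_kind :: "'c subst \<Rightarrow> ('a, 'c) kind \<Rightarrow> ('a, 'c) kind \<Rightarrow> bool" where
  "hsub_kind \<theta> KType KType"
| "fresh_for x \<theta> \<Longrightarrow> hsub_type \<theta> A A' \<Longrightarrow> hsub_kind \<theta> K K' \<Longrightarrow>
    hsub_kind \<theta> (kpi x A K) (kpi x A' K')"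

inductive hsub_ctx :: "'c subst \<Rightarrow> ('a, 'c) lfctx \<Rightarrow> ('a, 'c) lfctx \<Rightarrow> bool" where
  "hsub_ctx \<theta> Empty Empty"
| "fresh_for x \<theta> \<Longrightarrow> hsub_ctx \<theta> \<Gamma> \<Gamma>' \<Longrightarrow> hsub_type \<theta> A A' \<Longrightarrow>
    hsub_ctx \<theta> (Extend \<Gamma> x A) (Extend \<Gamma>' x A')"

definition arity_preserving :: "'c subst \<Rightarrow> 'c actx \<Rightarrow> bool" where
  "arity_preserving \<theta> \<Theta> \<longleftrightarrow> (\<forall>(x, M, \<alpha>) \<in> \<theta>. \<Theta> \<turnstile> M :\<^sub>a \<alpha>)"

definition arity_compatible :: "'c subst \<Rightarrow> 'c subst \<Rightarrow> 'c actx \<Rightarrow> bool" where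
  "arity_compatible \<theta>1 \<theta>2 \<Theta> \<longleftrightarrow>
     arity_preserving \<theta>2 \<Theta> \<and> arity_preserving \<theta>1 (ctx \<theta>2 \<oplus> \<Theta>)"

definition comp_subst :: "'c subst \<Rightarrow> 'c subst \<Rightarrow> 'c subst" (infixl \<open>\<circ>\<^sub>s\<close> 55) where
  "\<theta>2 \<circ>\<^sub>s \<theta>1 =
     {(x, M', \<alpha>) |x M' \<alpha>. \<exists>M. (x, M, \<alpha>) \<in> \<theta>1 \<and> hsub \<theta>2 M M'} \<union>
     {(y, N, \<beta>). (y, N, \<beta>) \<in> \<theta>2 \<and> y \<notin> Domain \<theta>1}"

text \<open>\<open>lc_* k\<close>: all \<open>Bound\<close> indices point to a binder of the expression or are below \<open>k\<close>.\<close>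

primrec lc_cterm :: "nat \<Rightarrow> 'c cterm \<Rightarrow> bool" and lc_aterm :: "nat \<Rightarrow> 'c aterm \<Rightarrow> bool" where
  "lc_cterm k (Atm R) \<longleftrightarrow> lc_aterm k R"
| "lc_cterm k (Lam M) \<longleftrightarrow> lc_cterm (Suc k) M"
| "lc_aterm k (Const c) \<longleftrightarrow> True"
| "lc_aterm k (Free x) \<longleftrightarrow> True"
| "lc_aterm k (Bound i) \<longleftrightarrow> i < k"
| "lc_aterm k (App R M) \<longleftrightarrow> lc_aterm k R \<and> lc_cterm k M"

primrec lc_atype :: "nat \<Rightarrow> ('a, 'c) atype \<Rightarrow> bool" where
  "lc_atype k (TConst a) \<longleftrightarrow> True"
| "lc_atype k (TApp P M) \<longleftrightarrow> lc_atype k P \<and> lc_cterm k M"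

primrec lc_ctype :: "nat \<Rightarrow> ('a, 'c) ctype \<Rightarrow> bool" where
  "lc_ctype k (TAtm P) \<longleftrightarrow> lc_atype k P"
| "lc_ctype k (TPi A B) \<longleftrightarrow> lc_ctype k A \<and> lc_ctype (Suc k) B"

primrec lc_kind :: "nat \<Rightarrow> ('a, 'c) kind \<Rightarrow> bool" where
  "lc_kind k KType \<longleftrightarrow> True"
| "lc_kind k (KPi A K) \<longleftrightarrow> lc_ctype k A \<and> lc_kind (Suc k) K"

lemma lc_close_term:
  fixes M :: "'c cterm" and R :: "'c aterm"
  shows
  "lc_cterm k M \<Longrightarrow> lc_cterm (Suc k) (close_cterm k x M)"
  "lc_aterm k R \<Longrightarrow> lc_aterm (Suc k) (close_aterm k x R)"
  by (induction M and R arbitrary: k and k rule: cterm.induct aterm.induct) auto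

lemma lc_close_atype: "lc_atype k P \<Longrightarrow> lc_atype (Suc k) (close_atype k x P)"
  by (induction P) (auto simp: lc_close_term)

lemma lc_close_ctype: "lc_ctype k A \<Longrightarrow> lc_ctype (Suc k) (close_ctype k x A)"
  by (induction A arbitrary: k) (auto simp: lc_close_atype)

lemma lc_close_kind: "lc_kind k K \<Longrightarrow> lc_kind (Suc k) (close_kind k x K)"
  by (induction K arbitrary: k) (auto simp: lc_close_ctype)

lemma lc_arity_typing:
  "\<Theta> \<turnstile> R \<Rrightarrow> \<alpha> \<Longrightarrow> lc_aterm 0 R"
  "\<Theta> \<turnstile> M :\<^sub>a \<alpha> \<Longrightarrow> lc_cterm 0 M"
  by (induction rule: synth_check.inducts) (auto simp: lam_def lc_close_term)

lemma lc_respects_type: "respects_type \<Theta> A \<Longrightarrow> lc_ctype 0 A"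
proof (induction rule: respects_type.induct)
  case (1 P \<Theta>)
  then show ?case by (induction P) (auto dest: lc_arity_typing)
qed (auto simp: tpi_def lc_close_ctype)

lemma lc_respects_kind: "respects_kind \<Theta> K \<Longrightarrow> lc_kind 0 K"
  by (induction rule: respects_kind.induct)
    (auto simp: kpi_def lc_respects_type lc_close_kind)

text \<open>
  Hence the terms in arity preserving substitutions are locally closed as well, so the following
  applies to all the substitutions that matter.
\<close>

lemma lc_hsub:
  "hsub \<theta> M M' \<Longrightarrow> \<forall>(x, N, \<beta>) \<in> \<theta>. lc_cterm 0 N \<Longrightarrow> lc_cterm 0 M \<and> lc_cterm 0 M'"
  "hsub_ra \<theta> R R' \<Longrightarrow> \<forall>(x, N, \<beta>) \<in> \<theta>. lc_cterm 0 N \<Longrightarrow> lc_aterm 0 R \<and> lc_aterm 0 R'"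
  "hsub_rc \<theta> R M \<alpha> \<Longrightarrow> \<forall>(x, N, \<beta>) \<in> \<theta>. lc_cterm 0 N \<Longrightarrow> lc_aterm 0 R \<and> lc_cterm 0 M"
  by (induction rule: hsub_hsub_ra_hsub_rc.inducts) (auto simp: lam_def lc_close_term)

end

theory Submission
  imports Defs
begin

text \<open>
  The critical case is a redex: \<open>[\<theta>1]\<close> turns the head of \<open>R M\<close> into \<open>\<lambda>x. L\<close> of arity type
  \<open>\<beta> \<rightarrow> \<alpha>\<close> and \<open>M\<close> into \<open>N\<close>, and continues with \<open>{\<langle>x, N, \<beta>\<rangle>}\<close> in \<open>L\<close>.  Commuting that
  substitution with \<open>\<theta>2\<close> amounts to composing the pairs \<open>({\<langle>x, N, \<beta>\<rangle>}, \<theta>2)\<close> and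
  \<open>(\<theta>2, {\<langle>x, [\<theta>2]N, \<beta>\<rangle>})\<close>, each read in order of application.  For fresh \<open>x\<close> their two
  compositions are the same substitution, so the results agree because hereditary substitution
  is a function, total on arity typed terms.  As \<open>\<beta>\<close> is strictly smaller than some
  arity type in \<open>\<theta>1\<close>, the sum of the maximal sizes of the arity types of the two substitutions decreases for
  both pairs, so the proof is by induction on that sum and, inside it, on the size of the term.
\<close>

subsection \<open>Renaming\<close>

primrec ren_cterm :: "(var \<Rightarrow> var) \<Rightarrow> 'c cterm \<Rightarrow> 'c cterm"
  and ren_aterm :: "(var \<Rightarrow> var) \<Rightarrow> 'c aterm \<Rightarrow> 'c aterm" where
  "ren_cterm p (Atm R) = Atm (ren_aterm p R)"
| "ren_cterm p (Lam M) = Lam (ren_cterm p M)"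
| "ren_aterm p (Const c) = Const c"
| "ren_aterm p (Free x) = Free (p x)"
| "ren_aterm p (Bound i) = Bound i"
| "ren_aterm p (App R M) = App (ren_aterm p R) (ren_cterm p M)"

lemma finite_fv [simp]:
  fixes M :: "'c cterm" and R :: "'c aterm"
  shows "finite (fv_cterm M)" "finite (fv_aterm R)"
  by (induction M and R) auto

lemma fv_close [simp]:
  fixes M :: "'c cterm" and R :: "'c aterm"
  shows "fv_cterm (close_cterm k x M) = fv_cterm M - {x}"
    "fv_aterm (close_aterm k x R) = fv_aterm R - {x}"
  by (induction M and R arbitrary: k and k) auto

lemma fv_lam [simp]: "fv_cterm (lam x M) = fv_cterm M - {x}"
  by (simp add: lam_def)

lemma fv_ren [simp]:
  fixes M :: "'c cterm" and R :: "'c aterm"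
  shows "fv_cterm (ren_cterm p M) = p ` fv_cterm M"
    "fv_aterm (ren_aterm p R) = p ` fv_aterm R"
  by (induction M and R) auto

lemma ren_cong:
  fixes M :: "'c cterm" and R :: "'c aterm"
  shows "(\<And>y. y \<in> fv_cterm M \<Longrightarrow> p y = q y) \<Longrightarrow> ren_cterm p M = ren_cterm q M"
    "(\<And>y. y \<in> fv_aterm R \<Longrightarrow> p y = q y) \<Longrightarrow> ren_aterm p R = ren_aterm q R"
  by (induction M and R) auto

lemma Atm_neq_lam [simp]: "Atm R \<noteq> lam x M" "lam x M \<noteq> Atm R"
  by (auto simp: lam_def)

lemma ren_id [simp]:
  fixes M :: "'c cterm" and R :: "'c aterm"
  shows "ren_cterm id M = M" "ren_aterm id R = R"
  by (induction M and R) auto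

lemma ren_upd_idle [simp]: "x \<notin> fv_cterm M \<Longrightarrow> ren_cterm (p(x := z)) M = ren_cterm p M"
  by (rule ren_cong) auto

text \<open>The name \<open>z\<close> takes the place of the bound variable \<open>x\<close>. It
  only has to miss the images of the other free variables, which closing at \<open>z\<close> would
  capture; elsewhere \<open>p\<close> may identify names.\<close>

lemma ren_close:
  fixes M :: "'c cterm" and R :: "'c aterm"
  shows "z \<notin> p ` (fv_cterm M - {x}) \<Longrightarrow>
      ren_cterm p (close_cterm k x M) = close_cterm k z (ren_cterm (p(x := z)) M)"
    "z \<notin> p ` (fv_aterm R - {x}) \<Longrightarrow>
      ren_aterm p (close_aterm k x R) = close_aterm k z (ren_aterm (p(x := z)) R)"
  by (induction M and R arbitrary: k and k) auto

lemma ren_lam: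
  "z \<notin> p ` (fv_cterm M - {x}) \<Longrightarrow> ren_cterm p (lam x M) = lam z (ren_cterm (p(x := z)) M)"
  by (simp add: lam_def ren_close)

text \<open>Alpha-conversion for \<open>lam\<close>, obtained from \<open>ren_lam\<close> with the
  identity as outer renaming.\<close>

lemma lam_rename: "z \<notin> fv_cterm M - {x} \<Longrightarrow> lam x M = lam z (ren_cterm (id(x := z)) M)"
  using ren_lam[of z id M x] by simp

lemma size_close [simp]:
  fixes M :: "'c cterm" and R :: "'c aterm"
  shows "size (close_cterm k x M) = size M" "size (close_aterm k x R) = size R"
  by (induction M and R arbitrary: k and k) auto

text \<open>A dangling \<open>Bound k\<close> and a closed variable end up as the same index, so
  both bodies have to be locally closed at \<open>k\<close>. Then each \<open>Bound k\<close> of the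
  common result stems from the abstracted name.\<close>

lemma close_eqD:
  fixes M M' :: "'c cterm" and R R' :: "'c aterm"
  shows "close_cterm k x M = close_cterm k y M' \<Longrightarrow> lc_cterm k M \<Longrightarrow> lc_cterm k M' \<Longrightarrow>
      M = ren_cterm (id(y := x)) M' \<and> x \<notin> fv_cterm M' - {y}"
    "close_aterm k x R = close_aterm k y R' \<Longrightarrow> lc_aterm k R \<Longrightarrow> lc_aterm k R' \<Longrightarrow>
      R = ren_aterm (id(y := x)) R' \<and> x \<notin> fv_aterm R' - {y}"
proof (induction M and R arbitrary: k M' and k R')
  case (Atm R)
  show ?case
  proof (cases M')
    case (Atm R')
    then show ?thesis using Atm.IH[of k R'] Atm.prems by auto
  qed (use Atm.prems in auto)
next
  case (Lam M)
  show ?case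
  proof (cases M')
    case (Lam N)
    then show ?thesis using Lam.IH[of "Suc k" N] Lam.prems by auto
  qed (use Lam.prems in auto)
next
  case (App R M)
  show ?case
  proof (cases R')
    case (App S N)
    then show ?thesis using App.IH(1)[of k S] App.IH(2)[of k N] App.prems by auto
  qed (use App.prems in \<open>auto split: if_splits\<close>)
next
  case (Const c) then show ?case by (cases R') (auto split: if_splits)
next
  case (Free z) then show ?case by (cases R') (auto split: if_splits)
next
  case (Bound i) then show ?case by (cases R') (auto split: if_splits)
qed

lemma lam_eqD:
  "lam x M = lam y M' \<Longrightarrow> lc_cterm 0 M \<Longrightarrow> lc_cterm 0 M' \<Longrightarrow>
    M = ren_cterm (id(y := x)) M' \<and> x \<notin> fv_cterm M' - {y}"
  unfolding lam_def by (drule cterm.inject(2)[THEN iffD1]) (rule close_eqD(1))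

text \<open>Stands in for an opening operation: the dangling index \<open>k\<close> is replaced by
  the name \<open>x\<close>, and closing recovers it exactly because \<open>x\<close> occurs nowhere
  else.\<close>

lemma ex_close:
  fixes M :: "'c cterm" and R :: "'c aterm"
  shows "lc_cterm (Suc k) M \<Longrightarrow> x \<notin> fv_cterm M \<Longrightarrow> \<exists>M'. M = close_cterm k x M' \<and> lc_cterm k M'"
    "lc_aterm (Suc k) R \<Longrightarrow> x \<notin> fv_aterm R \<Longrightarrow> \<exists>R'. R = close_aterm k x R' \<and> lc_aterm k R'"
proof (induction M and R arbitrary: k and k)
  case (Atm R) then show ?case
    by (metis close_cterm.simps(1) fv_cterm.simps(1) lc_cterm.simps(1))
next
  case (Lam M) then show ?case
    by (metis close_cterm.simps(2) fv_cterm.simps(2) lc_cterm.simps(2))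
next
  case (Const c) then show ?case by (intro exI[of _ "Const c"]) auto
next
  case (Free z) then show ?case by (intro exI[of _ "Free z"]) auto
next
  case (Bound i) then show ?case
    by (intro exI[of _ "if i = k then Free x else Bound i"]) auto
next
  case (App R M) then show ?case
    by (metis UnCI close_aterm.simps(4) fv_aterm.simps(4) lc_aterm.simps(4))
qed

text \<open>The body gets a name of choice without growing, as inductions on \<open>size\<close>
  need it under a binder.\<close>

lemma ex_lam:
  assumes "lc_cterm 0 (Lam t)" and "x \<notin> fv_cterm t"
  obtains M where "Lam t = lam x M" "lc_cterm 0 M" "size M = size t"
  using assms ex_close(1)[of 0 t x] by (auto simp: lam_def)

lemma lc_lam [simp]: "lc_cterm 0 M \<Longrightarrow> lc_cterm 0 (lam x M)"
  by (simp add: lam_def lc_close_term)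

lemma ex_fresh: "finite F \<Longrightarrow> \<exists>x::var. x \<notin> F"
  by (rule ex_new_if_finite) auto

section \<open>Supports of substitutions, and hereditary substitution under renaming of free
  variables\<close>

definition rng_fv :: "'c subst \<Rightarrow> var set" where
  "rng_fv \<theta> = (\<Union>(y, M, \<alpha>) \<in> \<theta>. fv_cterm M)"

definition supp :: "'c subst \<Rightarrow> var set" where
  "supp \<theta> = Domain \<theta> \<union> rng_fv \<theta>"

lemma finite_supp [simp]: "finite \<theta> \<Longrightarrow> finite (supp \<theta>)"
  by (auto simp: supp_def rng_fv_def finite_Domain)

lemma fresh_for_iff: "fresh_for x \<theta> \<longleftrightarrow> x \<notin> supp \<theta>"
  by (auto simp: fresh_for_def supp_def rng_fv_def)

lemma fresh_forD:
  assumes "fresh_for x \<theta>"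
  shows "x \<notin> Domain \<theta>" "(y, N, \<beta>) \<in> \<theta> \<Longrightarrow> x \<notin> fv_cterm N"
  using assms by (auto simp: fresh_for_def)

lemma fv_hsub:
  "hsub \<theta> M M' \<Longrightarrow> fv_cterm M' \<subseteq> (fv_cterm M - Domain \<theta>) \<union> rng_fv \<theta>"
  "hsub_ra \<theta> R R' \<Longrightarrow> fv_aterm R' \<subseteq> (fv_aterm R - Domain \<theta>) \<union> rng_fv \<theta>"
  "hsub_rc \<theta> R M \<alpha> \<Longrightarrow> fv_cterm M \<subseteq> (fv_aterm R - Domain \<theta>) \<union> rng_fv \<theta>"
proof (induction rule: hsub_hsub_ra_hsub_rc.inducts)
  case (hsub_rc_Free x M \<alpha> \<theta>)
  then show ?case by (force simp: rng_fv_def)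
next
  case (hsub_rc_App \<theta> R x M' \<alpha>' \<alpha>'' M M'' M''')
  \<comment> \<open>The contracting substitution has domain \<open>x\<close> and takes its free
    variables from \<open>M''\<close>, so the bound name drops out.\<close>
  then have "fv_cterm M''' \<subseteq> (fv_cterm M' - {x}) \<union> fv_cterm M''" by (simp add: rng_fv_def)
  with hsub_rc_App show ?case by auto
qed auto

text \<open>Only results contain terms taken from \<theta>; subjects are built by the rules alone,
  none of which has a \<open>Bound\<close> as subject. Hence nothing is asked of \<theta>, in
  contrast to \<open>lc_hsub\<close>.\<close>

lemma lc_hsub_input:
  "hsub \<theta> M M' \<Longrightarrow> lc_cterm 0 M"
  "hsub_ra \<theta> R R' \<Longrightarrow> lc_aterm 0 R"
  "hsub_rc \<theta> R M \<alpha> \<Longrightarrow> lc_aterm 0 R"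
  by (induction rule: hsub_hsub_ra_hsub_rc.inducts) auto

text \<open>
  Renaming the subject by \<open>p\<close> and the result by a different \<open>q\<close> is what allows changing the bound
  variable \<open>x\<close> of a redex in \<open>{\<langle>x, N, \<beta>\<rangle>}\<close> while leaving \<open>N\<close>, in which \<open>x\<close> may occur, untouched.
  Neither map needs to be injective.
\<close>

definition renames :: "var set \<Rightarrow> (var \<Rightarrow> var) \<Rightarrow> (var \<Rightarrow> var) \<Rightarrow> 'c subst \<Rightarrow> 'c subst \<Rightarrow> bool" where
  "renames V p q \<theta> \<theta>' \<longleftrightarrow> finite \<theta>' \<and> (\<forall>y \<in> V.
     (\<forall>N \<alpha>. (y, N, \<alpha>) \<in> \<theta> \<longrightarrow> (p y, ren_cterm q N, \<alpha>) \<in> \<theta>') \<and>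
     (y \<notin> Domain \<theta> \<longrightarrow> p y = q y \<and> q y \<notin> Domain \<theta>'))"

lemma renames_mono: "renames V p q \<theta> \<theta>' \<Longrightarrow> W \<subseteq> V \<Longrightarrow> renames W p q \<theta> \<theta>'"
  unfolding renames_def by blast

lemma hsub_ren:
  "hsub \<theta> M M' \<Longrightarrow> renames (fv_cterm M) p q \<theta> \<theta>' \<Longrightarrow>
    hsub \<theta>' (ren_cterm p M) (ren_cterm q M')"
  "hsub_ra \<theta> R R' \<Longrightarrow> renames (fv_aterm R) p q \<theta> \<theta>' \<Longrightarrow>
    hsub_ra \<theta>' (ren_aterm p R) (ren_aterm q R')"
  "hsub_rc \<theta> R N \<alpha> \<Longrightarrow> renames (fv_aterm R) p q \<theta> \<theta>' \<Longrightarrow>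
    hsub_rc \<theta>' (ren_aterm p R) (ren_cterm q N) \<alpha>"
proof (induction arbitrary: p q \<theta>' and p q \<theta>' and p q \<theta>' rule: hsub_hsub_ra_hsub_rc.inducts)
  case (hsub_lam x \<theta> M M')
  have fin: "finite \<theta>'" using hsub_lam.prems by (simp add: renames_def)
  obtain z where z: "z \<notin> supp \<theta>' \<union> p ` fv_cterm M \<union> q ` fv_cterm M'"
    using ex_fresh[of "supp \<theta>' \<union> p ` fv_cterm M \<union> q ` fv_cterm M'"] fin by auto
  \<comment> \<open>Both maps send \<open>x\<close> to the same fresh \<open>z\<close>, so they
    agree at \<open>x\<close>, which lies outside the domain of \<theta>. The terms in \<theta> do
    not mention \<open>x\<close> and do not see the update.\<close>
  have "renames (fv_cterm M) (p(x := z)) (q(x := z)) \<theta> \<theta>'"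
    unfolding renames_def
  proof (intro conjI ballI fin)
    fix y assume y: "y \<in> fv_cterm M"
    show "\<forall>N \<alpha>. (y, N, \<alpha>) \<in> \<theta> \<longrightarrow> ((p(x := z)) y, ren_cterm (q(x := z)) N, \<alpha>) \<in> \<theta>'"
      using y hsub_lam.prems fresh_forD[OF hsub_lam.hyps(1)] by (auto simp: renames_def)
    show "y \<notin> Domain \<theta> \<longrightarrow> (p(x := z)) y = (q(x := z)) y \<and> (q(x := z)) y \<notin> Domain \<theta>'"
      using y hsub_lam.prems z by (auto simp: renames_def supp_def)
  qed
  then have "hsub \<theta>' (lam z (ren_cterm (p(x := z)) M)) (lam z (ren_cterm (q(x := z)) M'))"
    using hsub_lam.IH z by (intro hsub_hsub_ra_hsub_rc.hsub_lam) (auto simp: fresh_for_iff)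
  then show ?case using z by (subst (1 2) ren_lam[of z]) auto
next
  case (hsub_rc_App \<theta> R x M' \<alpha>' \<alpha>'' M M'' M''')
  obtain z where z: "z \<notin> q ` fv_cterm M'"
    using ex_fresh[of "q ` fv_cterm M'"] by auto
  have "renames (fv_aterm R) p q \<theta> \<theta>'" "renames (fv_cterm M) p q \<theta> \<theta>'"
    using hsub_rc_App.prems by (auto elim: renames_mono)
  moreover have "ren_cterm q (lam x M') = lam z (ren_cterm (q(x := z)) M')"
    using z by (intro ren_lam) auto
  \<comment> \<open>As part of a result, \<open>M'\<close> is renamed by \<open>q\<close>, with its
    bound \<open>x\<close> going to \<open>z\<close>. The argument \<open>M''\<close> and the final
    result use \<open>q\<close> without the update: here the maps for subject and result
    differ.\<close>
  moreover have "renames (fv_cterm M') (q(x := z)) q {(x, M'', \<alpha>')} {(z, ren_cterm q M'', \<alpha>')}"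
    using z by (auto simp: renames_def)
  ultimately show ?case
    using hsub_rc_App.IH by (metis ren_aterm.simps(4) hsub_hsub_ra_hsub_rc.hsub_rc_App)
next
  case (hsub_ra_App \<theta> R R' M M')
  moreover have "renames (fv_aterm R) p q \<theta> \<theta>'" "renames (fv_cterm M) p q \<theta> \<theta>'"
    using hsub_ra_App.prems by (auto elim: renames_mono)
  ultimately show ?case by (auto intro!: hsub_hsub_ra_hsub_rc.hsub_ra_App)
qed (auto simp: renames_def intro: hsub_hsub_ra_hsub_rc.intros)

text \<open>The rule only provides some bound name \<open>y\<close>. Since \<open>x\<close> and
  \<open>y\<close> are both fresh for \<theta>, renaming \<open>y\<close> to \<open>x\<close> leaves
  \<theta> fixed and transports the derivation to the requested name.\<close>

lemma hsub_lamD: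
  assumes "hsub \<theta> (lam x M) T" and fr: "fresh_for x \<theta>" and fin: "finite \<theta>" and lc: "lc_cterm 0 M"
  obtains M' where "T = lam x M'" "hsub \<theta> M M'"
proof -
  from assms(1) obtain y M1 M2 where y: "lam x M = lam y M1" "T = lam y M2" "fresh_for y \<theta>"
    "hsub \<theta> M1 M2"
    by (cases rule: hsub.cases) (auto simp: lam_def)
  have M: "M = ren_cterm (id(y := x)) M1" "x \<notin> fv_cterm M1 - {y}"
    using lam_eqD[OF y(1) lc] lc_hsub_input(1)[OF y(4)] by auto
  have "renames (fv_cterm M1) (id(y := x)) (id(y := x)) \<theta> \<theta>"
    using fin fr y(3) by (auto simp: renames_def dest: fresh_forD)
  then have "hsub \<theta> M (ren_cterm (id(y := x)) M2)"
    using hsub_ren(1)[OF y(4)] M by blast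
  moreover have "x \<notin> fv_cterm M2 - {y}"
    using fv_hsub(1)[OF y(4)] M(2) fr by (auto simp: rng_fv_def dest: fresh_forD)
  ultimately show ?thesis using that y(2) lam_rename by metis
qed

text \<open>Contraction does not depend on the bound name: \<open>y\<close> becomes \<open>x\<close>
  in the subject while the result is renamed by \<open>id\<close>, so \<open>N\<close> and
  \<open>T\<close> stay as they are even if \<open>N\<close> contains one of the names.\<close>

lemma hsub_single_rename:
  assumes "hsub {(y, N, \<alpha>)} M T" "lam x M' = lam y M" "lc_cterm 0 M'"
  shows "hsub {(x, N, \<alpha>)} M' T"
proof -
  have M: "M' = ren_cterm (id(y := x)) M" "x \<notin> fv_cterm M - {y}"
    using lam_eqD[OF assms(2,3)] lc_hsub_input(1)[OF assms(1)] by auto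
  have "renames (fv_cterm M) (id(y := x)) id {(y, N, \<alpha>)} {(x, N, \<alpha>)}"
    using M(2) by (auto simp: renames_def)
  from hsub_ren(1)[OF assms(1) this] show ?thesis using M(1) by simp
qed

inductive_cases hsub_AtmE: "hsub \<theta> (Atm R) T"
inductive_cases hsub_ra_AppE: "hsub_ra \<theta> (App R M) T"
inductive_cases hsub_rc_AppE: "hsub_rc \<theta> (App R M) T \<alpha>"
inductive_cases hsub_ra_FreeE: "hsub_ra \<theta> (Free x) T"
inductive_cases hsub_rc_FreeE: "hsub_rc \<theta> (Free x) T \<alpha>"
inductive_cases hsub_ra_ConstE: "hsub_ra \<theta> (Const x) T"
inductive_cases hsub_rc_ConstE: "hsub_rc \<theta> (Const x) T \<alpha>"

text \<open>The head decides the form: a variable in the domain leads to \<open>hsub_rc\<close>, any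
  other variable or a constant to \<open>hsub_ra\<close>, and an application inherits the form of
  its head.\<close>

lemma hsub_ra_not_rc: "hsub_ra \<theta> R R' \<Longrightarrow> \<not> hsub_rc \<theta> R N \<alpha>"
proof (induction arbitrary: N \<alpha> rule: hsub_hsub_ra_hsub_rc.inducts(2)
    [where ?P1.0 = "\<lambda>_ _ _. True" and ?P3.0 = "\<lambda>_ _ _ _. True"])
  case (hsub_ra_Free x \<theta>)
  then show ?case by (auto elim: hsub_rc_FreeE)
next
  case (hsub_ra_App \<theta> R R' M M')
  then show ?case by (metis hsub_rc_AppE)
next
  case (hsub_ra_Const \<theta> c)
  then show ?case by (auto elim: hsub_rc_ConstE)
qed simp_all

subsection \<open>Determinism\<close>

lemma substitution_single [simp]: "substitution {(x, M, \<alpha>)}"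
  by (auto simp: substitution_def single_valued_def)

text \<open>Being single-valued ties a name to the pair of its term and its arity type, so the arity
  type of \<open>hsub_rc\<close> is determined along with the term.\<close>

lemma hsub_det:
  "hsub \<theta> M M1 \<Longrightarrow> substitution \<theta> \<Longrightarrow> hsub \<theta> M M2 \<Longrightarrow> M1 = M2"
  "hsub_ra \<theta> R R1 \<Longrightarrow> substitution \<theta> \<Longrightarrow> hsub_ra \<theta> R R2 \<Longrightarrow> R1 = R2"
  "hsub_rc \<theta> R N1 \<alpha>1 \<Longrightarrow> substitution \<theta> \<Longrightarrow> hsub_rc \<theta> R N2 \<alpha>2 \<Longrightarrow> N1 = N2 \<and> \<alpha>1 = \<alpha>2"
proof (induction arbitrary: M2 and R2 and N2 \<alpha>2 rule: hsub_hsub_ra_hsub_rc.inducts)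
  case (hsub_ra \<theta> R R')
  from hsub_ra.prems(2) show ?case
  proof (rule hsub_AtmE)
    fix R'' assume "M2 = Atm R''" "hsub_ra \<theta> R R''"
    then show ?thesis using hsub_ra.IH hsub_ra.prems(1) by simp
  next
    fix \<alpha> assume "hsub_rc \<theta> R M2 \<alpha>"
    then show ?thesis using hsub_ra_not_rc[OF hsub_ra.hyps] by simp
  qed
next
  case (hsub_rc \<theta> R M' \<alpha>')
  from hsub_rc.prems(2) show ?case
  proof (rule hsub_AtmE)
    fix R'' assume "hsub_ra \<theta> R R''"
    then show ?thesis using hsub_ra_not_rc hsub_rc.hyps by blast
  next
    fix \<alpha> assume "hsub_rc \<theta> R M2 \<alpha>"
    then show ?thesis using hsub_rc.IH hsub_rc.prems(1) by simp
  qed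
next
  case (hsub_lam x \<theta> M M')
  obtain M2' where "M2 = lam x M2'" "hsub \<theta> M M2'"
  proof (rule hsub_lamD[OF hsub_lam.prems(2) hsub_lam.hyps(1)])
    show "finite \<theta>" using hsub_lam.prems(1) by (simp add: substitution_def)
    show "lc_cterm 0 M" using lc_hsub_input(1)[OF hsub_lam.hyps(2)] .
  qed
  then show ?case using hsub_lam.IH hsub_lam.prems(1) by simp
next
  case (hsub_rc_Free x M \<alpha> \<theta>)
  from hsub_rc_Free.prems(2) have "(x, N2, \<alpha>2) \<in> \<theta>" by (rule hsub_rc_FreeE)
  then have "(N2, \<alpha>2) = (M, \<alpha>)"
    using hsub_rc_Free by (auto simp: substitution_def dest: single_valuedD)
  then show ?case by simp
next
  case (hsub_rc_App \<theta> R x M' \<alpha>' \<alpha>'' M M'' M''')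
  from hsub_rc_App.prems(2) obtain y N' \<beta> N'' where
    y: "hsub_rc \<theta> R (lam y N') (\<beta> \<rightarrow>\<^sub>a \<alpha>2)" "hsub \<theta> M N''" "hsub {(y, N'', \<beta>)} N' N2"
    by (rule hsub_rc_AppE)
  have eq: "lam x M' = lam y N'" "\<alpha>' = \<beta>" "\<alpha>'' = \<alpha>2" "M'' = N''"
    using hsub_rc_App.IH(1)[OF hsub_rc_App.prems(1) y(1)]
      hsub_rc_App.IH(2)[OF hsub_rc_App.prems(1) y(2)] by auto
  \<comment> \<open>The second derivation may have opened the same abstraction with another name;
    renaming it to \<open>x\<close> makes the two contractions comparable.\<close>
  have "hsub {(x, M'', \<alpha>')} M' N2"
    using hsub_single_rename[OF y(3) eq(1)] lc_hsub_input(1)[OF hsub_rc_App.hyps(3)] eq by simp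
  then show ?case using hsub_rc_App.IH(3) eq by simp
next
  case (hsub_ra_Const \<theta> c)
  then show ?case by (auto elim: hsub_ra_ConstE)
next
  case (hsub_ra_Free x \<theta>)
  then show ?case by (auto elim: hsub_ra_FreeE)
next
  case (hsub_ra_App \<theta> R R' M M')
  from hsub_ra_App.prems(2) show ?case
  proof (rule hsub_ra_AppE)
    fix S N assume "R2 = App S N" "hsub_ra \<theta> R S" "hsub \<theta> M N"
    then show ?thesis using hsub_ra_App.IH hsub_ra_App.prems(1) by simp
  qed
qed

text \<open>The induction is on \<open>size\<close> because the body of a \<open>Lam\<close> is
  opened with a fresh name and is then no subterm. Local closedness excludes dangling indices, on
  which no rule acts.\<close>

lemma hsub_vacuous:
  "(\<forall>M :: 'c cterm. size M = n \<longrightarrow> lc_cterm 0 M \<longrightarrow> fv_cterm M \<inter> Domain \<theta> = {} \<longrightarrow> hsub \<theta> M M) \<and>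
   (\<forall>R :: 'c aterm. size R = n \<longrightarrow> lc_aterm 0 R \<longrightarrow> fv_aterm R \<inter> Domain \<theta> = {} \<longrightarrow> hsub_ra \<theta> R R)"
  if fin: "finite \<theta>"
proof (induction n rule: less_induct)
  case (less n)
  show ?case
  proof (intro conjI allI impI)
    fix M :: "'c cterm"
    assume M: "size M = n" "lc_cterm 0 M" "fv_cterm M \<inter> Domain \<theta> = {}"
    show "hsub \<theta> M M"
    proof (cases M)
      case (Atm R)
      then show ?thesis using M less.IH[of "size R"] by (auto intro: hsub_ra)
    next
      case (Lam t)
      obtain x where x: "x \<notin> supp \<theta> \<union> fv_cterm t"
        using ex_fresh[of "supp \<theta> \<union> fv_cterm t"] fin by auto
      obtain N where N: "Lam t = lam x N" "lc_cterm 0 N" "size N = size t"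
        using ex_lam[of t x] M Lam x by auto
      have "fv_cterm N \<subseteq> insert x (fv_cterm t)" using arg_cong[OF N(1), of fv_cterm] by auto
      moreover have "x \<notin> Domain \<theta>" using x by (auto simp: supp_def)
      ultimately have "fv_cterm N \<inter> Domain \<theta> = {}" using M(3) Lam by auto
      moreover have "size N < n" using M(1) Lam N(3) by simp
      ultimately have "hsub \<theta> N N" using less.IH N(2) by blast
      then show ?thesis using Lam N x by (auto intro: hsub_lam simp: fresh_for_iff)
    qed
  next
    fix R :: "'c aterm"
    assume R: "size R = n" "lc_aterm 0 R" "fv_aterm R \<inter> Domain \<theta> = {}"
    show "hsub_ra \<theta> R R"
    proof (cases R)
      case (App S N)
      then have "fv_aterm S \<inter> Domain \<theta> = {}" "fv_cterm N \<inter> Domain \<theta> = {}" using R by auto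
      moreover have "size S < n" "size N < n" "lc_aterm 0 S" "lc_cterm 0 N" using R App by auto
      ultimately have "hsub_ra \<theta> S S" "hsub \<theta> N N" using less.IH by blast+
      then show ?thesis unfolding App by (rule hsub_ra_App)
    qed (use R in \<open>auto intro: hsub_ra_Const hsub_ra_Free\<close>)
  qed
qed

lemma hsub_vacuous_eq:
  assumes "lc_cterm 0 M" "substitution \<theta>" "fv_cterm M \<inter> Domain \<theta> = {}"
  shows "hsub \<theta> M M' \<longleftrightarrow> M' = M"
  using assms hsub_vacuous[of \<theta>] hsub_det(1) unfolding substitution_def by blast

subsection \<open>Arity typing and totality\<close>

lemma oplus_iff: "(s, \<alpha>) \<in> \<Theta>1 \<oplus> \<Theta>2 \<longleftrightarrow> (s, \<alpha>) \<in> \<Theta>1 \<or> (s, \<alpha>) \<in> \<Theta>2 \<and> s \<notin> Domain \<Theta>1"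
  by (auto simp: oplus_def)

lemma oplus_assoc: "(\<Theta>1 \<oplus> \<Theta>2) \<oplus> \<Theta>3 = \<Theta>1 \<oplus> \<Theta>2 \<oplus> \<Theta>3"
  by (auto simp: oplus_def)

lemma oplus_commute: "Domain \<Theta>1 \<inter> Domain \<Theta>2 = {} \<Longrightarrow> \<Theta>1 \<oplus> \<Theta>2 \<oplus> \<Theta> = \<Theta>2 \<oplus> \<Theta>1 \<oplus> \<Theta>"
  by (auto simp: oplus_def)

lemma Domain_ctx: "SVar x \<in> Domain (ctx \<theta>) \<longleftrightarrow> x \<in> Domain \<theta>"
  by (auto simp: ctx_def Domain.simps)

lemma ctx_single [simp]: "ctx {(x, M, \<alpha>)} = {(SVar x, \<alpha>)}"
  by (auto simp: ctx_def)

text \<open>Going under a binder adds the assignment of \<open>x\<close> in front of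
  \<open>ctx \<theta>\<close>, while induction hypotheses want it inside the base context. The two
  commute as \<open>x\<close> is outside the domain.\<close>

lemma ctx_oplus_fresh:
  "fresh_for x \<theta> \<Longrightarrow> {(SVar x, \<alpha>)} \<oplus> ctx \<theta> \<oplus> \<Theta> = ctx \<theta> \<oplus> {(SVar x, \<alpha>)} \<oplus> \<Theta>"
  by (rule oplus_commute) (auto dest: fresh_forD simp: Domain_ctx)

text \<open>Assignments are compared only at names in \<open>V\<close>, in use the free variables of
  the term. This covers renaming and, with \<open>p = id\<close>, weakening.\<close>

definition actx_ren :: "var set \<Rightarrow> (var \<Rightarrow> var) \<Rightarrow> 'c actx \<Rightarrow> 'c actx \<Rightarrow> bool" where
  "actx_ren V p \<Theta> \<Theta>' \<longleftrightarrow> (\<forall>c \<alpha>. (SConst c, \<alpha>) \<in> \<Theta> \<longrightarrow> (SConst c, \<alpha>) \<in> \<Theta>') \<and>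
    (\<forall>y \<in> V. \<forall>\<alpha>. (SVar y, \<alpha>) \<in> \<Theta> \<longrightarrow> (SVar (p y), \<alpha>) \<in> \<Theta>')"

lemma actx_ren_mono: "actx_ren V p \<Theta> \<Theta>' \<Longrightarrow> W \<subseteq> V \<Longrightarrow> actx_ren W p \<Theta> \<Theta>'"
  unfolding actx_ren_def by blast

lemma actx_ren_upd:
  "actx_ren (V - {x}) p \<Theta> \<Theta>' \<Longrightarrow> z \<notin> p ` (V - {x}) \<Longrightarrow>
    actx_ren V (p(x := z)) ({(SVar x, \<alpha>)} \<oplus> \<Theta>) ({(SVar z, \<alpha>)} \<oplus> \<Theta>')"
  by (auto simp: actx_ren_def oplus_iff)

lemma typing_ren:
  "\<Theta> \<turnstile> R \<Rrightarrow> \<alpha> \<Longrightarrow> actx_ren (fv_aterm R) p \<Theta> \<Theta>' \<Longrightarrow> \<Theta>' \<turnstile> ren_aterm p R \<Rrightarrow> \<alpha>"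
  "\<Theta> \<turnstile> M :\<^sub>a \<alpha> \<Longrightarrow> actx_ren (fv_cterm M) p \<Theta> \<Theta>' \<Longrightarrow> \<Theta>' \<turnstile> ren_cterm p M :\<^sub>a \<alpha>"
proof (induction arbitrary: p \<Theta>' and p \<Theta>' rule: synth_check.inducts)
  case (synth_App \<Theta> R \<alpha>' \<alpha> M)
  moreover have "actx_ren (fv_aterm R) p \<Theta> \<Theta>'" "actx_ren (fv_cterm M) p \<Theta> \<Theta>'"
    using synth_App.prems by (auto elim: actx_ren_mono)
  ultimately show ?case by (auto intro!: synth_check.synth_App)
next
  case (check_lam x \<alpha>1 \<Theta> M \<alpha>2)
  obtain z where z: "z \<notin> p ` fv_cterm M"
    using ex_fresh[of "p ` fv_cterm M"] by auto
  have "{(SVar z, \<alpha>1)} \<oplus> \<Theta>' \<turnstile> ren_cterm (p(x := z)) M :\<^sub>a \<alpha>2"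
    using check_lam.prems z by (intro check_lam.IH actx_ren_upd) auto
  then have "\<Theta>' \<turnstile> lam z (ren_cterm (p(x := z)) M) :\<^sub>a \<alpha>1 \<rightarrow>\<^sub>a \<alpha>2"
    by (rule synth_check.check_lam)
  then show ?case using z by (subst ren_lam[of z]) auto
qed (auto simp: actx_ren_def intro: synth_check.intros)

lemma check_weaken:
  assumes "\<Theta> \<turnstile> M :\<^sub>a \<alpha>" "x \<notin> fv_cterm M"
  shows "{(SVar x, \<beta>)} \<oplus> \<Theta> \<turnstile> M :\<^sub>a \<alpha>"
proof -
  have "actx_ren (fv_cterm M) id \<Theta> ({(SVar x, \<beta>)} \<oplus> \<Theta>)"
    using assms(2) by (auto simp: actx_ren_def oplus_iff)
  from typing_ren(2)[OF assms(1) this] show ?thesis by simp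
qed

section \<open>Inversion of arity typing\<close>

inductive_cases check_AtmE: "\<Theta> \<turnstile> Atm R :\<^sub>a \<alpha>"
inductive_cases synth_AppE: "\<Theta> \<turnstile> App R M \<Rrightarrow> \<alpha>"
inductive_cases synth_FreeE: "\<Theta> \<turnstile> Free x \<Rrightarrow> \<alpha>"
inductive_cases synth_ConstE: "\<Theta> \<turnstile> Const c \<Rrightarrow> \<alpha>"
inductive_cases synth_BoundE: "\<Theta> \<turnstile> Bound c \<Rrightarrow> \<alpha>"

text \<open>Typing counterpart of \<open>hsub_lamD\<close>. Here \<open>x\<close> may already be
  assigned in \<Theta>, since \<oplus> lets the new assignment win.\<close>

lemma check_lamD:
  assumes "\<Theta> \<turnstile> lam x M :\<^sub>a \<alpha>" "lc_cterm 0 M"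
  obtains \<alpha>1 \<alpha>2 where "\<alpha> = \<alpha>1 \<rightarrow>\<^sub>a \<alpha>2" "{(SVar x, \<alpha>1)} \<oplus> \<Theta> \<turnstile> M :\<^sub>a \<alpha>2"
proof -
  from assms(1) obtain y N \<alpha>1 \<alpha>2 where y: "lam x M = lam y N" "\<alpha> = \<alpha>1 \<rightarrow>\<^sub>a \<alpha>2"
    "{(SVar y, \<alpha>1)} \<oplus> \<Theta> \<turnstile> N :\<^sub>a \<alpha>2"
    by (cases rule: check.cases) auto
  have M: "M = ren_cterm (id(y := x)) N" "x \<notin> fv_cterm N - {y}"
    using lam_eqD[OF y(1) assms(2)] lc_arity_typing(2)[OF y(3)] by auto
  have "actx_ren (fv_cterm N) (id(y := x)) ({(SVar y, \<alpha>1)} \<oplus> \<Theta>) ({(SVar x, \<alpha>1)} \<oplus> \<Theta>)"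
    using M(2) by (intro actx_ren_upd) (auto simp: actx_ren_def)
  from typing_ren(2)[OF y(3) this] M y that show ?thesis by simp
qed

lemma check_Lam_cases:
  assumes "\<Theta> \<turnstile> Lam t :\<^sub>a \<alpha>" "finite F"
  obtains x M \<alpha>1 \<alpha>2 where "x \<notin> F" "Lam t = lam x M" "\<alpha> = \<alpha>1 \<rightarrow>\<^sub>a \<alpha>2"
    "{(SVar x, \<alpha>1)} \<oplus> \<Theta> \<turnstile> M :\<^sub>a \<alpha>2" "lc_cterm 0 M" "size M = size t"
proof -
  obtain x where x: "x \<notin> F \<union> fv_cterm t" using ex_fresh[of "F \<union> fv_cterm t"] assms(2) by auto
  obtain M where M: "Lam t = lam x M" "lc_cterm 0 M" "size M = size t"
    using ex_lam[of t x] lc_arity_typing(2)[OF assms(1)] x by auto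
  obtain \<alpha>1 \<alpha>2 where "\<alpha> = \<alpha>1 \<rightarrow>\<^sub>a \<alpha>2" "{(SVar x, \<alpha>1)} \<oplus> \<Theta> \<turnstile> M :\<^sub>a \<alpha>2"
    using check_lamD[of \<Theta> x M \<alpha>] assms(1) M by auto
  with M x that show ?thesis by auto
qed

text \<open>Bundles what both main inductions assume of a substitution. As \<open>n\<close> is any
  upper bound of the sizes, the empty substitution needs no convention for a maximum.\<close>

definition bounded_subst :: "nat \<Rightarrow> 'c subst \<Rightarrow> 'c actx \<Rightarrow> bool" where
  "bounded_subst n \<theta> \<Theta> \<longleftrightarrow>
     substitution \<theta> \<and> (\<forall>(x, M, \<alpha>) \<in> \<theta>. size \<alpha> \<le> n) \<and> arity_preserving \<theta> \<Theta>"

lemma bounded_substD: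
  assumes "bounded_subst n \<theta> \<Theta>"
  shows "substitution \<theta>" "finite \<theta>" "(x, M, \<alpha>) \<in> \<theta> \<Longrightarrow> size \<alpha> \<le> n" "(x, M, \<alpha>) \<in> \<theta> \<Longrightarrow> \<Theta> \<turnstile> M :\<^sub>a \<alpha>"
  using assms by (auto simp: bounded_subst_def substitution_def arity_preserving_def)

lemma bounded_subst_single: "\<Theta> \<turnstile> M :\<^sub>a \<alpha> \<Longrightarrow> bounded_subst (size \<alpha>) {(x, M, \<alpha>)} \<Theta>"
  by (simp add: bounded_subst_def arity_preserving_def)

lemma ex_bounded_subst:
  assumes "substitution \<theta>" "arity_preserving \<theta> \<Theta>"
  shows "\<exists>n. bounded_subst n \<theta> \<Theta>"
proof -
  have "finite ((\<lambda>(x, M, \<alpha>). size \<alpha>) ` \<theta>)" using assms by (simp add: substitution_def)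
  then obtain n where "\<forall>k \<in> (\<lambda>(x, M, \<alpha>). size \<alpha>) ` \<theta>. k \<le> n"
    unfolding finite_nat_set_iff_bounded_le by blast
  then show ?thesis using assms by (auto simp: bounded_subst_def)
qed

lemma bounded_subst_weaken:
  "bounded_subst n \<theta> \<Theta> \<Longrightarrow> fresh_for x \<theta> \<Longrightarrow> bounded_subst n \<theta> ({(SVar x, \<beta>)} \<oplus> \<Theta>)"
  by (auto simp: bounded_subst_def arity_preserving_def fresh_for_def intro!: check_weaken)

text \<open>The arity type reported by \<open>hsub_rc\<close> starts as the one \<theta> gives to
  the head variable and loses one argument per application, so it never grows.\<close>

lemma hsub_rc_size: "hsub_rc \<theta> R N \<alpha> \<Longrightarrow> (\<forall>(x, M, \<beta>) \<in> \<theta>. size \<beta> \<le> n) \<Longrightarrow> size \<alpha> \<le> n"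
  by (induction rule: hsub_hsub_ra_hsub_rc.inducts(3)
      [where ?P1.0 = "\<lambda>_ _ _. True" and ?P2.0 = "\<lambda>_ _ _. True"]) auto

text \<open>A redex is contracted at the argument type \<open>\<alpha>'\<close>; this strict
  inequality justifies the outer inductions on the bound.\<close>

lemma hsub_rc_arrow_size:
  assumes "hsub_rc \<theta> R N (\<alpha>' \<rightarrow>\<^sub>a \<alpha>)" "bounded_subst n \<theta> \<Theta>"
  shows "size \<alpha>' < n"
  using hsub_rc_size[OF assms(1), of n] assms(2) by (auto simp: bounded_subst_def)

text \<open>Well-typed canonical terms are eta-long: \<open>check_Atm\<close> types atomic terms at
  the base arity only, so a term of arrow arity is an abstraction.\<close>

lemma check_arrowD:
  assumes "\<Theta> \<turnstile> M :\<^sub>a \<alpha>1 \<rightarrow>\<^sub>a \<alpha>2" "finite F"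
  obtains x N where "x \<notin> F" "M = lam x N" "{(SVar x, \<alpha>1)} \<oplus> \<Theta> \<turnstile> N :\<^sub>a \<alpha>2" "lc_cterm 0 N"
proof (cases M)
  case (Atm R)
  then show ?thesis using assms(1) by (auto elim: check_AtmE)
next
  case (Lam t)
  with assms obtain x N \<beta>1 \<beta>2 where "x \<notin> F" "Lam t = lam x N" "\<alpha>1 \<rightarrow>\<^sub>a \<alpha>2 = \<beta>1 \<rightarrow>\<^sub>a \<beta>2"
    "{(SVar x, \<beta>1)} \<oplus> \<Theta> \<turnstile> N :\<^sub>a \<beta>2" "lc_cterm 0 N"
    by (metis check_Lam_cases)
  with Lam that show ?thesis by auto
qed

text \<open>A predicate of the bound and the term size, so that two strong inductions can be nested
  while substitution and context stay quantified. The \<open>itself\<close> argument carries the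
  type of constants.\<close>

definition hsub_total_upto :: "nat \<Rightarrow> nat \<Rightarrow> 'c itself \<Rightarrow> bool" where
  "hsub_total_upto n m t \<longleftrightarrow> (\<forall>(\<theta> :: 'c subst) \<Theta>. bounded_subst n \<theta> \<Theta> \<longrightarrow>
    (\<forall>M \<alpha>. size M = m \<longrightarrow> ctx \<theta> \<oplus> \<Theta> \<turnstile> M :\<^sub>a \<alpha> \<longrightarrow> (\<exists>M'. hsub \<theta> M M' \<and> \<Theta> \<turnstile> M' :\<^sub>a \<alpha>)) \<and>
    (\<forall>R \<alpha>. size R = m \<longrightarrow> ctx \<theta> \<oplus> \<Theta> \<turnstile> R \<Rrightarrow> \<alpha> \<longrightarrow>
      (\<exists>R'. hsub_ra \<theta> R R' \<and> \<Theta> \<turnstile> R' \<Rrightarrow> \<alpha>) \<or> (\<exists>M'. hsub_rc \<theta> R M' \<alpha> \<and> \<Theta> \<turnstile> M' :\<^sub>a \<alpha>)))"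

lemma hsub_total_uptoD:
  fixes \<theta> :: "'c subst"
  assumes "hsub_total_upto n m TYPE('c)" "bounded_subst n \<theta> \<Theta>"
  shows "size M = m \<Longrightarrow> ctx \<theta> \<oplus> \<Theta> \<turnstile> M :\<^sub>a \<alpha> \<Longrightarrow> \<exists>M'. hsub \<theta> M M' \<and> \<Theta> \<turnstile> M' :\<^sub>a \<alpha>"
    "size R = m \<Longrightarrow> ctx \<theta> \<oplus> \<Theta> \<turnstile> R \<Rrightarrow> \<alpha> \<Longrightarrow>
      (\<exists>R'. hsub_ra \<theta> R R' \<and> \<Theta> \<turnstile> R' \<Rrightarrow> \<alpha>) \<or> (\<exists>M'. hsub_rc \<theta> R M' \<alpha> \<and> \<Theta> \<turnstile> M' :\<^sub>a \<alpha>)"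
  using assms unfolding hsub_total_upto_def by blast+

lemma hsub_total_upto: "hsub_total_upto n m TYPE('c)"
proof (induction n arbitrary: m rule: less_induct)
  case (less n)
  note IH_arity = less.IH
  show ?case
  proof (induction m rule: less_induct)
    case (less m)
    note IH_size = less.IH
    show ?case
      unfolding hsub_total_upto_def
    proof (intro allI impI conjI)
      fix \<theta> :: "'c subst" and \<Theta> M \<alpha>
      assume bd: "bounded_subst n \<theta> \<Theta>" and m: "size M = m" and M: "ctx \<theta> \<oplus> \<Theta> \<turnstile> M :\<^sub>a \<alpha>"
      show "\<exists>M'. hsub \<theta> M M' \<and> \<Theta> \<turnstile> M' :\<^sub>a \<alpha>"
      proof (cases M)
        case (Atm R)
        with M have o: "\<alpha> = \<o>" and R: "ctx \<theta> \<oplus> \<Theta> \<turnstile> R \<Rrightarrow> \<o>" by (auto elim: check_AtmE)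
        have "size R < m" using m Atm by simp
        from hsub_total_uptoD(2)[OF IH_size[OF this] bd refl R] show ?thesis
          using Atm o by (auto intro: hsub_ra hsub_rc check_Atm)
      next
        case (Lam t)
        obtain x N \<alpha>1 \<alpha>2 where x: "x \<notin> supp \<theta>" and N: "Lam t = lam x N" "\<alpha> = \<alpha>1 \<rightarrow>\<^sub>a \<alpha>2"
          "{(SVar x, \<alpha>1)} \<oplus> ctx \<theta> \<oplus> \<Theta> \<turnstile> N :\<^sub>a \<alpha>2" "size N = size t"
          using check_Lam_cases[OF M[unfolded Lam], of "supp \<theta>"] bounded_substD(2)[OF bd]
          by (metis finite_supp)
        have fr: "fresh_for x \<theta>" using x by (simp add: fresh_for_iff)
        have "size N < m" using N(4) m Lam by simp
        then obtain N' where "hsub \<theta> N N'" "{(SVar x, \<alpha>1)} \<oplus> \<Theta> \<turnstile> N' :\<^sub>a \<alpha>2"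
          using hsub_total_uptoD(1)[OF IH_size bounded_subst_weaken[OF bd fr] refl] N(3)
          by (metis ctx_oplus_fresh[OF fr])
        then show ?thesis using Lam N fr by (metis hsub_lam check_lam)
      qed
    next
      fix \<theta> :: "'c subst" and \<Theta> R \<alpha>
      assume bd: "bounded_subst n \<theta> \<Theta>" and m: "size R = m" and R: "ctx \<theta> \<oplus> \<Theta> \<turnstile> R \<Rrightarrow> \<alpha>"
      show "(\<exists>R'. hsub_ra \<theta> R R' \<and> \<Theta> \<turnstile> R' \<Rrightarrow> \<alpha>) \<or> (\<exists>M'. hsub_rc \<theta> R M' \<alpha> \<and> \<Theta> \<turnstile> M' :\<^sub>a \<alpha>)"
      proof (cases R)
        case (Const c)
        then have "(SConst c, \<alpha>) \<in> \<Theta>"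
          using R by (auto elim!: synth_ConstE simp: oplus_iff ctx_def)
        then show ?thesis using Const by (auto intro: hsub_ra_Const synth_Const)
      next
        case (Bound i)
        then show ?thesis using R by (auto elim: synth_BoundE)
      next
        case (Free x)
        then have x: "(SVar x, \<alpha>) \<in> ctx \<theta> \<oplus> \<Theta>" using R by (auto elim: synth_FreeE)
        show ?thesis
        proof (cases "x \<in> Domain \<theta>")
          case True
          then have "(SVar x, \<alpha>) \<in> ctx \<theta>" using x Domain_ctx[of x \<theta>] by (auto simp: oplus_iff)
          then obtain N where "(x, N, \<alpha>) \<in> \<theta>" by (auto simp: ctx_def)
          then show ?thesis using Free bounded_substD(4)[OF bd] by (auto intro: hsub_rc_Free)
        next
          case False
          then have "(SVar x, \<alpha>) \<in> \<Theta>"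
            using x Domain_ctx[of x \<theta>] by (auto simp: oplus_iff)
          then show ?thesis using Free False by (auto intro: hsub_ra_Free synth_Free)
        qed
      next
        case (App S N)
        then obtain \<alpha>' where S: "ctx \<theta> \<oplus> \<Theta> \<turnstile> S \<Rrightarrow> \<alpha>' \<rightarrow>\<^sub>a \<alpha>" and N: "ctx \<theta> \<oplus> \<Theta> \<turnstile> N :\<^sub>a \<alpha>'"
          using R by (auto elim: synth_AppE)
        have sz: "size S < m" "size N < m" using m App by auto
        obtain N' where N': "hsub \<theta> N N'" "\<Theta> \<turnstile> N' :\<^sub>a \<alpha>'"
          using hsub_total_uptoD(1)[OF IH_size[OF sz(2)] bd refl N] by blast
        from hsub_total_uptoD(2)[OF IH_size[OF sz(1)] bd refl S] show ?thesis
        proof (elim disjE exE conjE)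
          fix S' assume "hsub_ra \<theta> S S'" "\<Theta> \<turnstile> S' \<Rrightarrow> \<alpha>' \<rightarrow>\<^sub>a \<alpha>"
          then show ?thesis using App N' by (auto intro: hsub_ra_App synth_App)
        next
          fix M' assume M': "hsub_rc \<theta> S M' (\<alpha>' \<rightarrow>\<^sub>a \<alpha>)" "\<Theta> \<turnstile> M' :\<^sub>a \<alpha>' \<rightarrow>\<^sub>a \<alpha>"
          obtain x L where L: "M' = lam x L" "{(SVar x, \<alpha>')} \<oplus> \<Theta> \<turnstile> L :\<^sub>a \<alpha>"
            using check_arrowD[OF M'(2) finite.emptyI] by metis
          have "ctx {(x, N', \<alpha>')} \<oplus> \<Theta> \<turnstile> L :\<^sub>a \<alpha>" using L by simp
          \<comment> \<open>Nothing relates the size of \<open>L\<close> to \<open>m\<close>. The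
            outer hypothesis covers terms of every size, since the singleton is bounded by
            \<open>size \<alpha>'\<close>, which is below \<open>n\<close>.\<close>
          then obtain L' where "hsub {(x, N', \<alpha>')} L L'" "\<Theta> \<turnstile> L' :\<^sub>a \<alpha>"
            using hsub_total_uptoD(1)[OF IH_arity[OF hsub_rc_arrow_size[OF M'(1) bd]]
                bounded_subst_single[OF N'(2)] refl] by blast
          then show ?thesis using App L M' N' by (auto intro: hsub_rc_App)
        qed
      qed
    qed
  qed
qed

lemma hsub_total:
  assumes "bounded_subst n \<theta> \<Theta>"
  shows "ctx \<theta> \<oplus> \<Theta> \<turnstile> M :\<^sub>a \<alpha> \<Longrightarrow> \<exists>M'. hsub \<theta> M M' \<and> \<Theta> \<turnstile> M' :\<^sub>a \<alpha>"
    "ctx \<theta> \<oplus> \<Theta> \<turnstile> R \<Rrightarrow> \<alpha> \<Longrightarrow>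
      (\<exists>R'. hsub_ra \<theta> R R' \<and> \<Theta> \<turnstile> R' \<Rrightarrow> \<alpha>) \<or> (\<exists>M'. hsub_rc \<theta> R M' \<alpha> \<and> \<Theta> \<turnstile> M' :\<^sub>a \<alpha>)"
  using hsub_total_uptoD[OF hsub_total_upto assms] by blast+

text \<open>No further induction: totality yields some well-typed result, and by determinism and
  \<open>hsub_ra_not_rc\<close> it is the given one.\<close>

lemma hsub_preserves:
  assumes bd: "bounded_subst n \<theta> \<Theta>"
  shows "ctx \<theta> \<oplus> \<Theta> \<turnstile> M :\<^sub>a \<alpha> \<Longrightarrow> hsub \<theta> M M' \<Longrightarrow> \<Theta> \<turnstile> M' :\<^sub>a \<alpha>"
    "ctx \<theta> \<oplus> \<Theta> \<turnstile> R \<Rrightarrow> \<alpha> \<Longrightarrow> hsub_ra \<theta> R R' \<Longrightarrow> \<Theta> \<turnstile> R' \<Rrightarrow> \<alpha>"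
    "ctx \<theta> \<oplus> \<Theta> \<turnstile> R \<Rrightarrow> \<alpha> \<Longrightarrow> hsub_rc \<theta> R N \<beta> \<Longrightarrow> \<beta> = \<alpha> \<and> \<Theta> \<turnstile> N :\<^sub>a \<alpha>"
  using hsub_total[OF bd] hsub_det[OF _ bounded_substD(1)[OF bd]] hsub_ra_not_rc by metis+

subsection \<open>Composition on terms\<close>

lemma comp_substI1: "(x, M, \<alpha>) \<in> \<theta>1 \<Longrightarrow> hsub \<theta>2 M M' \<Longrightarrow> (x, M', \<alpha>) \<in> \<theta>2 \<circ>\<^sub>s \<theta>1"
  by (auto simp: comp_subst_def)

lemma comp_substI2: "(x, M, \<alpha>) \<in> \<theta>2 \<Longrightarrow> x \<notin> Domain \<theta>1 \<Longrightarrow> (x, M, \<alpha>) \<in> \<theta>2 \<circ>\<^sub>s \<theta>1"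
  by (auto simp: comp_subst_def)

lemma Domain_comp_subst: "Domain (\<theta>2 \<circ>\<^sub>s \<theta>1) \<subseteq> Domain \<theta>1 \<union> Domain \<theta>2"
  by (auto simp: comp_subst_def)

lemma fresh_for_comp:
  assumes "fresh_for x \<theta>1" "fresh_for x \<theta>2"
  shows "fresh_for x (\<theta>2 \<circ>\<^sub>s \<theta>1)"
  unfolding fresh_for_def
proof (intro conjI ballI, safe)
  fix M \<alpha> assume "(x, M, \<alpha>) \<in> \<theta>2 \<circ>\<^sub>s \<theta>1"
  then show False using Domain_comp_subst[of \<theta>2 \<theta>1] assms by (auto simp: fresh_for_def)
next
  fix y M \<alpha> assume "(y, M, \<alpha>) \<in> \<theta>2 \<circ>\<^sub>s \<theta>1" and x: "x \<in> fv_cterm M"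
  then consider N where "(y, N, \<alpha>) \<in> \<theta>1" "hsub \<theta>2 N M" | "(y, M, \<alpha>) \<in> \<theta>2"
    by (auto simp: comp_subst_def)
  then show False
  proof cases
    case 1
    then show False using fv_hsub(1)[OF 1(2)] x fresh_forD(2)[OF assms(1) 1(1)] fresh_forD(2)[OF assms(2)]
      by (auto simp: rng_fv_def)
  next
    case 2
    then show False using x fresh_forD(2)[OF assms(2)] by blast
  qed
qed

text \<open>An entry of \<theta>1 could be lost in the composition only if \<theta>2 had no result
  on its term, which totality rules out.\<close>

lemma ctx_comp_subst:
  assumes "bounded_subst n1 \<theta>1 (ctx \<theta>2 \<oplus> \<Theta>)" "bounded_subst n2 \<theta>2 \<Theta>"
  shows "ctx (\<theta>2 \<circ>\<^sub>s \<theta>1) \<oplus> \<Theta> = ctx \<theta>1 \<oplus> ctx \<theta>2 \<oplus> \<Theta>"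
proof -
  have ex: "\<exists>M'. hsub \<theta>2 M M'" if "(x, M, \<alpha>) \<in> \<theta>1" for x M \<alpha>
    using hsub_total(1)[OF assms(2) bounded_substD(4)[OF assms(1) that]] by blast
  have "(s, \<alpha>) \<in> ctx (\<theta>2 \<circ>\<^sub>s \<theta>1) \<longleftrightarrow> (s, \<alpha>) \<in> ctx \<theta>1 \<oplus> ctx \<theta>2" for s \<alpha>
  proof (cases s)
    case (SVar x)
    have "(\<exists>M. (x, M, \<alpha>) \<in> \<theta>2 \<circ>\<^sub>s \<theta>1) \<longleftrightarrow>
        (\<exists>M. (x, M, \<alpha>) \<in> \<theta>1) \<or> (\<exists>M. (x, M, \<alpha>) \<in> \<theta>2) \<and> x \<notin> Domain \<theta>1"
      by (simp add: comp_subst_def) (metis ex)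
    then show ?thesis
      unfolding SVar oplus_iff Domain_ctx by (simp add: ctx_def)
  qed (auto simp: ctx_def oplus_def)
  then have "ctx (\<theta>2 \<circ>\<^sub>s \<theta>1) = ctx \<theta>1 \<oplus> ctx \<theta>2" by (auto simp: set_eq_iff)
  then show ?thesis by (simp add: oplus_assoc)
qed

text \<open>Determinism makes \<open>N\<close> the only image of \<open>M\<close>, and as
  \<open>x\<close> is not in the domain of \<theta>, no entry of \<theta> is dropped.\<close>

lemma comp_subst_single:
  assumes "substitution \<theta>" "fresh_for x \<theta>" "hsub \<theta> M N"
  shows "\<theta> \<circ>\<^sub>s {(x, M, \<alpha>)} = insert (x, N, \<alpha>) \<theta>"
proof -
  have "hsub \<theta> M P \<longleftrightarrow> P = N" for P using hsub_det(1)[OF _ assms(1)] assms(3) by blast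
  then show ?thesis using fresh_forD(1)[OF assms(2)] by (auto simp: comp_subst_def)
qed

text \<open>The terms in \<theta> are locally closed and free of \<open>x\<close>, so the singleton
  acts on them as the identity. With \<open>comp_subst_single\<close> this equates the two orders of
  composition at a redex.\<close>

lemma single_comp_subst:
  assumes "bounded_subst n \<theta> \<Theta>" "fresh_for x \<theta>"
  shows "{(x, N, \<alpha>)} \<circ>\<^sub>s \<theta> = insert (x, N, \<alpha>) \<theta>"
proof -
  have "hsub {(x, N, \<alpha>)} P P' \<longleftrightarrow> P' = P" if "(y, P, \<beta>) \<in> \<theta>" for y P P' \<beta>
    using lc_arity_typing(2)[OF bounded_substD(4)[OF assms(1) that]] fresh_forD(2)[OF assms(2) that]
    by (intro hsub_vacuous_eq) auto
  then show ?thesis using fresh_forD(1)[OF assms(2)] by (auto simp: comp_subst_def)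
qed

lemma substitution_insert:
  "substitution \<theta> \<Longrightarrow> fresh_for x \<theta> \<Longrightarrow> substitution (insert (x, N, \<alpha>) \<theta>)"
  using fresh_forD(1)[of x \<theta>] by (auto simp: substitution_def single_valued_def)

text \<open>The measure is the sum of the two bounds, hence insensitive to the order of the pair;
  \<open>hsub_single_swap\<close> uses both orders.\<close>

definition hsub_comp_upto :: "nat \<Rightarrow> nat \<Rightarrow> 'c itself \<Rightarrow> bool" where
  "hsub_comp_upto n m t \<longleftrightarrow> (\<forall>n1 n2 (\<theta>1 :: 'c subst) \<theta>2 \<Theta>. n = n1 + n2 \<longrightarrow>
    bounded_subst n1 \<theta>1 (ctx \<theta>2 \<oplus> \<Theta>) \<longrightarrow> bounded_subst n2 \<theta>2 \<Theta> \<longrightarrow>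
    (\<forall>M \<alpha> M' M''. size M = m \<longrightarrow> ctx \<theta>1 \<oplus> ctx \<theta>2 \<oplus> \<Theta> \<turnstile> M :\<^sub>a \<alpha> \<longrightarrow>
      hsub \<theta>1 M M' \<longrightarrow> hsub \<theta>2 M' M'' \<longrightarrow> hsub (\<theta>2 \<circ>\<^sub>s \<theta>1) M M'') \<and>
    (\<forall>R \<alpha>. size R = m \<longrightarrow> ctx \<theta>1 \<oplus> ctx \<theta>2 \<oplus> \<Theta> \<turnstile> R \<Rrightarrow> \<alpha> \<longrightarrow>
      (\<forall>M' M''. hsub_rc \<theta>1 R M' \<alpha> \<longrightarrow> hsub \<theta>2 M' M'' \<longrightarrow> hsub_rc (\<theta>2 \<circ>\<^sub>s \<theta>1) R M'' \<alpha>) \<and>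
      (\<forall>R' M''. hsub_ra \<theta>1 R R' \<longrightarrow> hsub_rc \<theta>2 R' M'' \<alpha> \<longrightarrow> hsub_rc (\<theta>2 \<circ>\<^sub>s \<theta>1) R M'' \<alpha>) \<and>
      (\<forall>R' R''. hsub_ra \<theta>1 R R' \<longrightarrow> hsub_ra \<theta>2 R' R'' \<longrightarrow> hsub_ra (\<theta>2 \<circ>\<^sub>s \<theta>1) R R'')))"

lemma hsub_comp_uptoD:
  fixes \<theta>1 :: "'c subst"
  assumes "hsub_comp_upto (n1 + n2) m TYPE('c)"
    "bounded_subst n1 \<theta>1 (ctx \<theta>2 \<oplus> \<Theta>)" "bounded_subst n2 \<theta>2 \<Theta>"
  shows "size M = m \<Longrightarrow> ctx \<theta>1 \<oplus> ctx \<theta>2 \<oplus> \<Theta> \<turnstile> M :\<^sub>a \<alpha> \<Longrightarrow>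
      hsub \<theta>1 M M' \<Longrightarrow> hsub \<theta>2 M' M'' \<Longrightarrow> hsub (\<theta>2 \<circ>\<^sub>s \<theta>1) M M''"
    "size R = m \<Longrightarrow> ctx \<theta>1 \<oplus> ctx \<theta>2 \<oplus> \<Theta> \<turnstile> R \<Rrightarrow> \<alpha> \<Longrightarrow>
      hsub_rc \<theta>1 R M' \<alpha> \<Longrightarrow> hsub \<theta>2 M' M'' \<Longrightarrow> hsub_rc (\<theta>2 \<circ>\<^sub>s \<theta>1) R M'' \<alpha>"
    "size R = m \<Longrightarrow> ctx \<theta>1 \<oplus> ctx \<theta>2 \<oplus> \<Theta> \<turnstile> R \<Rrightarrow> \<alpha> \<Longrightarrow>
      hsub_ra \<theta>1 R R' \<Longrightarrow> hsub_rc \<theta>2 R' M'' \<alpha> \<Longrightarrow> hsub_rc (\<theta>2 \<circ>\<^sub>s \<theta>1) R M'' \<alpha>"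
    "size R = m \<Longrightarrow> ctx \<theta>1 \<oplus> ctx \<theta>2 \<oplus> \<Theta> \<turnstile> R \<Rrightarrow> \<alpha> \<Longrightarrow>
      hsub_ra \<theta>1 R R' \<Longrightarrow> hsub_ra \<theta>2 R' R'' \<Longrightarrow> hsub_ra (\<theta>2 \<circ>\<^sub>s \<theta>1) R R''"
  using assms unfolding hsub_comp_upto_def by blast+

text \<open>The commuting square at a redex. One side is given and passes through \<open>K\<close>;
  the other exists by totality, ends in \<open>K2\<close>, and is shown to reach the same
  term.\<close>

lemma hsub_single_swap:
  fixes \<theta> :: "'c subst"
  assumes IH: "\<And>k m. k < n1 + n2 \<Longrightarrow> hsub_comp_upto k m TYPE('c)"
    and bd: "bounded_subst n2 \<theta> \<Theta>" and fr: "fresh_for x \<theta>" and sz: "size \<beta> < n1"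
    and L: "{(SVar x, \<beta>)} \<oplus> ctx \<theta> \<oplus> \<Theta> \<turnstile> L :\<^sub>a \<alpha>" and N: "ctx \<theta> \<oplus> \<Theta> \<turnstile> N :\<^sub>a \<beta>"
    and NL: "hsub {(x, N, \<beta>)} L K" "hsub \<theta> K K'" and N': "hsub \<theta> N N'" and L': "hsub \<theta> L L'"
  shows "hsub {(x, N', \<beta>)} L' K'"
proof -
  have L2: "ctx \<theta> \<oplus> {(SVar x, \<beta>)} \<oplus> \<Theta> \<turnstile> L :\<^sub>a \<alpha>" using L ctx_oplus_fresh[OF fr] by metis
  note bd2 = bounded_subst_weaken[OF bd fr, of \<beta>]
  have tN': "\<Theta> \<turnstile> N' :\<^sub>a \<beta>" by (rule hsub_preserves(1)[OF bd N N'])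
  have tL': "ctx {(x, N', \<beta>)} \<oplus> \<Theta> \<turnstile> L' :\<^sub>a \<alpha>" using hsub_preserves(1)[OF bd2 L2 L'] by simp
  obtain K2 where K2: "hsub {(x, N', \<beta>)} L' K2"
    using hsub_total(1)[OF bounded_subst_single[OF tN'] tL'] by blast
  \<comment> \<open>First pair: the singleton, then \<theta>. \<open>L\<close> may be large, but
    \<open>IH\<close> holds for all term sizes below the sum \<open>n1 + n2\<close>.\<close>
  have "hsub (\<theta> \<circ>\<^sub>s {(x, N, \<beta>)}) L K'"
    using IH[of "size \<beta> + n2"] sz L NL
    by (intro hsub_comp_uptoD(1)[OF _ bounded_subst_single[OF N] bd refl]) auto
  then have K': "hsub (insert (x, N', \<beta>) \<theta>) L K'"
    using comp_subst_single[OF bounded_substD(1)[OF bd] fr N'] by simp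
  \<comment> \<open>Second pair: \<theta>, then the singleton with the substituted argument; the sum
    of the bounds is the same.\<close>
  have "hsub ({(x, N', \<beta>)} \<circ>\<^sub>s \<theta>) L K2"
  proof (rule hsub_comp_uptoD(1)[OF _ _ bounded_subst_single[OF tN'] refl _ L' K2])
    show "hsub_comp_upto (n2 + size \<beta>) (size L) TYPE('c)" using IH sz by simp
  qed (use bd2 L2 in simp_all)
  then have "hsub (insert (x, N', \<beta>) \<theta>) L K2" using single_comp_subst[OF bd fr] by simp
  with K' have "K' = K2"
    using hsub_det(1) substitution_insert[OF bounded_substD(1)[OF bd] fr] by blast
  with K2 show ?thesis by simp
qed

lemma hsub_comp_upto: "hsub_comp_upto n m TYPE('c)"
proof (induction n arbitrary: m rule: less_induct)
  case (less n)
  note IH_arity = less.IH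
  show ?case
  proof (induction m rule: less_induct)
    case (less m)
    note IH_size = less.IH
    show ?case
      unfolding hsub_comp_upto_def
    proof (intro allI impI)
      fix n1 n2 and \<theta>1 \<theta>2 :: "'c subst" and \<Theta>
      assume n: "n = n1 + n2" and bd1: "bounded_subst n1 \<theta>1 (ctx \<theta>2 \<oplus> \<Theta>)"
        and bd2: "bounded_subst n2 \<theta>2 \<Theta>"
      note IH = hsub_comp_uptoD[OF IH_size[unfolded n] _ _ refl]
      let ?\<Theta> = "ctx \<theta>1 \<oplus> ctx \<theta>2 \<oplus> \<Theta>" and ?\<theta> = "\<theta>2 \<circ>\<^sub>s \<theta>1"
      have terms: "hsub ?\<theta> M M''" if m: "size M = m" and M: "?\<Theta> \<turnstile> M :\<^sub>a \<alpha>"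
        and M': "hsub \<theta>1 M M'" and M'': "hsub \<theta>2 M' M''" for M \<alpha> M' M''
      proof (cases M)
        case (Atm R)
        with M have R: "?\<Theta> \<turnstile> R \<Rrightarrow> \<o>" by (auto elim: check_AtmE)
        have sz: "size R < m" using Atm m by simp
        from M'[unfolded Atm] show ?thesis
        proof (rule hsub_AtmE)
          \<comment> \<open>\<open>hsub\<close> hides the arity type, while the induction hypothesis
            speaks of the synthesized one; preservation equates them.\<close>
          fix \<alpha>' assume rc: "hsub_rc \<theta>1 R M' \<alpha>'"
          then have "\<alpha>' = \<o>" using hsub_preserves(3)[OF bd1 R] by blast
          then show ?thesis
            using IH(2)[OF sz bd1 bd2 R] rc M'' Atm by (auto intro: hsub_rc)
        next
          fix R' assume R': "M' = Atm R'" "hsub_ra \<theta>1 R R'"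
          have tR': "ctx \<theta>2 \<oplus> \<Theta> \<turnstile> R' \<Rrightarrow> \<o>" by (rule hsub_preserves(2)[OF bd1 R R'(2)])
          from M''[unfolded R'(1)] show ?thesis
          proof (rule hsub_AtmE)
            fix \<alpha>' assume rc: "hsub_rc \<theta>2 R' M'' \<alpha>'"
            then have "\<alpha>' = \<o>" using hsub_preserves(3)[OF bd2 tR'] by blast
            then show ?thesis
              using IH(3)[OF sz bd1 bd2 R R'(2)] rc Atm by (auto intro: hsub_rc)
          next
            fix R'' assume "M'' = Atm R''" "hsub_ra \<theta>2 R' R''"
            then show ?thesis
              using IH(4)[OF sz bd1 bd2 R R'(2)] Atm by (auto intro: hsub_ra)
          qed
        qed
      next
        case (Lam t)
        let ?F = "supp \<theta>1 \<union> supp \<theta>2"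
        have "finite ?F" using bounded_substD(2)[OF bd1] bounded_substD(2)[OF bd2] by simp
        then obtain x N \<alpha>1 \<alpha>2 where x: "x \<notin> ?F" and N: "Lam t = lam x N"
          "{(SVar x, \<alpha>1)} \<oplus> ?\<Theta> \<turnstile> N :\<^sub>a \<alpha>2" "lc_cterm 0 N" "size N = size t"
          using check_Lam_cases[OF M[unfolded Lam]] by metis
        have fr: "fresh_for x \<theta>1" "fresh_for x \<theta>2" using x by (auto simp: fresh_for_iff)
        obtain N' where N': "M' = lam x N'" "hsub \<theta>1 N N'"
          using hsub_lamD[OF _ fr(1) bounded_substD(2)[OF bd1] N(3)] M' Lam N(1) by metis
        have ty: "ctx \<theta>1 \<oplus> ctx \<theta>2 \<oplus> {(SVar x, \<alpha>1)} \<oplus> \<Theta> \<turnstile> N :\<^sub>a \<alpha>2"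
          using N(2) ctx_oplus_fresh[OF fr(1)] ctx_oplus_fresh[OF fr(2)] by metis
        have b1: "bounded_subst n1 \<theta>1 (ctx \<theta>2 \<oplus> {(SVar x, \<alpha>1)} \<oplus> \<Theta>)"
          using bounded_subst_weaken[OF bd1 fr(1)] ctx_oplus_fresh[OF fr(2)] by metis
        note b2 = bounded_subst_weaken[OF bd2 fr(2), of \<alpha>1]
        have "lc_cterm 0 N'"
          using lc_arity_typing(2)[OF hsub_preserves(1)[OF b1 ty N'(2)]] .
        then obtain N'' where N'': "M'' = lam x N''" "hsub \<theta>2 N' N''"
          using hsub_lamD[OF _ fr(2) bounded_substD(2)[OF bd2]] M'' N'(1) by metis
        have "size N < m" using N(4) m Lam by simp
        then have "hsub ?\<theta> N N''" by (rule IH(1)[OF _ b1 b2 ty N'(2) N''(2)])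
        then show ?thesis
          using Lam N(1) N''(1) hsub_lam[OF fresh_for_comp[OF fr]] by metis
      qed
      have rc1: "hsub_rc ?\<theta> R M'' \<alpha>" if m: "size R = m" and R: "?\<Theta> \<turnstile> R \<Rrightarrow> \<alpha>"
        and M': "hsub_rc \<theta>1 R M' \<alpha>" and M'': "hsub \<theta>2 M' M''" for R \<alpha> M' M''
      proof (cases R)
        case (App S N)
        then obtain \<alpha>' where S: "?\<Theta> \<turnstile> S \<Rrightarrow> \<alpha>' \<rightarrow>\<^sub>a \<alpha>" and N: "?\<Theta> \<turnstile> N :\<^sub>a \<alpha>'"
          using R by (auto elim: synth_AppE)
        have sz: "size S < m" "size N < m" using m App by auto
        from M'[unfolded App] obtain y L0 \<beta> N1 where y: "hsub_rc \<theta>1 S (lam y L0) (\<beta> \<rightarrow>\<^sub>a \<alpha>)"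
          "hsub \<theta>1 N N1" "hsub {(y, N1, \<beta>)} L0 M'"
          by (rule hsub_rc_AppE)
        have \<beta>: "\<beta> = \<alpha>'" and tL0: "ctx \<theta>2 \<oplus> \<Theta> \<turnstile> lam y L0 :\<^sub>a \<alpha>' \<rightarrow>\<^sub>a \<alpha>"
          using hsub_preserves(3)[OF bd1 S y(1)] by auto
        have tN1: "ctx \<theta>2 \<oplus> \<Theta> \<turnstile> N1 :\<^sub>a \<alpha>'" by (rule hsub_preserves(1)[OF bd1 N y(2)])
        \<comment> \<open>The binder \<open>y\<close> supplied by the derivation may clash with
          \<theta>2, so the abstraction is reopened at a name fresh for \<theta>2.\<close>
        obtain x L where x: "x \<notin> supp \<theta>2" and L: "lam y L0 = lam x L"
          "{(SVar x, \<alpha>')} \<oplus> ctx \<theta>2 \<oplus> \<Theta> \<turnstile> L :\<^sub>a \<alpha>" "lc_cterm 0 L"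
          using check_arrowD[OF tL0] bounded_substD(2)[OF bd2] by (metis finite_supp)
        have fr: "fresh_for x \<theta>2" using x by (simp add: fresh_for_iff)
        have LM': "hsub {(x, N1, \<alpha>')} L M'"
          using hsub_single_rename[OF y(3)] L(1,3) \<beta> by metis
        obtain N2 where N2: "hsub \<theta>2 N1 N2" using hsub_total(1)[OF bd2 tN1] by blast
        obtain L2 where L2: "hsub \<theta>2 L L2"
          using hsub_total(1)[OF bounded_subst_weaken[OF bd2 fr]] L(2) ctx_oplus_fresh[OF fr] by metis
        have "hsub_rc ?\<theta> S (lam x L2) (\<alpha>' \<rightarrow>\<^sub>a \<alpha>)"
          using IH(2)[OF sz(1) bd1 bd2 S] y(1) L(1) \<beta> hsub_lam[OF fr L2] by metis
        moreover have "hsub ?\<theta> N N2" by (rule IH(1)[OF sz(2) bd1 bd2 N y(2) N2])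
        \<comment> \<open>The given derivations contract first and apply \<theta>2 afterwards; the
          rule for the composition asks for the contraction of parts to which \<theta>2 has already
          been applied.\<close>
        moreover have "hsub {(x, N2, \<alpha>')} L2 M''"
          using hsub_single_swap[OF IH_arity[unfolded n] bd2 fr _ L(2) tN1 LM' M'' N2 L2]
            hsub_rc_arrow_size[OF y(1) bd1] \<beta> by simp
        ultimately show ?thesis unfolding App by (rule hsub_rc_App)
      next
        case (Free x)
        then have "(x, M', \<alpha>) \<in> \<theta>1" using M' by (auto elim: hsub_rc_FreeE)
        then show ?thesis using Free M'' by (auto intro: hsub_rc_Free comp_substI1)
      qed (use M' in \<open>auto elim: hsub_rc.cases\<close>)
      have rc2: "hsub_rc ?\<theta> R M'' \<alpha>" if m: "size R = m" and R: "?\<Theta> \<turnstile> R \<Rrightarrow> \<alpha>"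
        and R': "hsub_ra \<theta>1 R R'" and M'': "hsub_rc \<theta>2 R' M'' \<alpha>" for R \<alpha> R' M''
      proof (cases R)
        case (App S N)
        then obtain \<alpha>' where S: "?\<Theta> \<turnstile> S \<Rrightarrow> \<alpha>' \<rightarrow>\<^sub>a \<alpha>" and N: "?\<Theta> \<turnstile> N :\<^sub>a \<alpha>'"
          using R by (auto elim: synth_AppE)
        have sz: "size S < m" "size N < m" using m App by auto
        from R'[unfolded App] obtain S1 N1 where 1: "R' = App S1 N1" "hsub_ra \<theta>1 S S1"
          "hsub \<theta>1 N N1"
          by (rule hsub_ra_AppE)
        from M''[unfolded 1(1)] obtain x L \<beta> N2 where 2: "hsub_rc \<theta>2 S1 (lam x L) (\<beta> \<rightarrow>\<^sub>a \<alpha>)"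
          "hsub \<theta>2 N1 N2" "hsub {(x, N2, \<beta>)} L M''"
          by (rule hsub_rc_AppE)
        have "\<beta> = \<alpha>'"
          using hsub_preserves(3)[OF bd2 hsub_preserves(2)[OF bd1 S 1(2)] 2(1)] by simp
        then have "hsub_rc ?\<theta> S (lam x L) (\<beta> \<rightarrow>\<^sub>a \<alpha>)"
          using IH(3)[OF sz(1) bd1 bd2 S 1(2)] 2(1) by simp
        \<comment> \<open>Here \<theta>2 creates the redex, so its contraction reappears unchanged
          for the composition and nothing has to be commuted.\<close>
        then show ?thesis
          unfolding App using IH(1)[OF sz(2) bd1 bd2 N 1(3) 2(2)] 2(3) by (rule hsub_rc_App)
      next
        case (Free x)
        then have "R' = Free x" "x \<notin> Domain \<theta>1" using R' by (auto elim: hsub_ra_FreeE)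
        moreover from this have "(x, M'', \<alpha>) \<in> \<theta>2" using M'' by (auto elim: hsub_rc_FreeE)
        ultimately show ?thesis using Free by (auto intro: hsub_rc_Free comp_substI2)
      next
        case (Const c)
        then have "R' = Const c" using R' by (auto elim: hsub_ra_ConstE)
        then show ?thesis using M'' by (auto elim: hsub_rc_ConstE)
      qed (use R in \<open>auto elim: synth_BoundE\<close>)
      have ra: "hsub_ra ?\<theta> R R''" if m: "size R = m" and R: "?\<Theta> \<turnstile> R \<Rrightarrow> \<alpha>"
        and R': "hsub_ra \<theta>1 R R'" and R'': "hsub_ra \<theta>2 R' R''" for R \<alpha> R' R''
      proof (cases R)
        case (App S N)
        then obtain \<alpha>' where S: "?\<Theta> \<turnstile> S \<Rrightarrow> \<alpha>' \<rightarrow>\<^sub>a \<alpha>" and N: "?\<Theta> \<turnstile> N :\<^sub>a \<alpha>'"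
          using R by (auto elim: synth_AppE)
        have sz: "size S < m" "size N < m" using m App by auto
        from R'[unfolded App] obtain S1 N1 where 1: "R' = App S1 N1" "hsub_ra \<theta>1 S S1"
          "hsub \<theta>1 N N1"
          by (rule hsub_ra_AppE)
        from R''[unfolded 1(1)] obtain S2 N2 where 2: "R'' = App S2 N2" "hsub_ra \<theta>2 S1 S2"
          "hsub \<theta>2 N1 N2"
          by (rule hsub_ra_AppE)
        show ?thesis
          unfolding App 2(1)
          using IH(4)[OF sz(1) bd1 bd2 S 1(2) 2(2)] IH(1)[OF sz(2) bd1 bd2 N 1(3) 2(3)]
          by (rule hsub_ra_App)
      next
        case (Free x)
        then have x: "R' = Free x" "x \<notin> Domain \<theta>1" using R' by (auto elim: hsub_ra_FreeE)
        then have "R'' = Free x" "x \<notin> Domain \<theta>2" using R'' by (auto elim: hsub_ra_FreeE)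
        then show ?thesis using Free x Domain_comp_subst[of \<theta>2 \<theta>1] by (auto intro!: hsub_ra_Free)
      next
        case (Const c)
        then have "R' = Const c" using R' by (auto elim: hsub_ra_ConstE)
        then show ?thesis using R'' Const by (auto elim!: hsub_ra_ConstE intro: hsub_ra_Const)
      qed (use R in \<open>auto elim: synth_BoundE\<close>)
      show "(\<forall>M \<alpha> M' M''. size M = m \<longrightarrow> ?\<Theta> \<turnstile> M :\<^sub>a \<alpha> \<longrightarrow>
          hsub \<theta>1 M M' \<longrightarrow> hsub \<theta>2 M' M'' \<longrightarrow> hsub ?\<theta> M M'') \<and>
        (\<forall>R \<alpha>. size R = m \<longrightarrow> ?\<Theta> \<turnstile> R \<Rrightarrow> \<alpha> \<longrightarrow>
          (\<forall>M' M''. hsub_rc \<theta>1 R M' \<alpha> \<longrightarrow> hsub \<theta>2 M' M'' \<longrightarrow> hsub_rc ?\<theta> R M'' \<alpha>) \<and>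
          (\<forall>R' M''. hsub_ra \<theta>1 R R' \<longrightarrow> hsub_rc \<theta>2 R' M'' \<alpha> \<longrightarrow> hsub_rc ?\<theta> R M'' \<alpha>) \<and>
          (\<forall>R' R''. hsub_ra \<theta>1 R R' \<longrightarrow> hsub_ra \<theta>2 R' R'' \<longrightarrow> hsub_ra ?\<theta> R R''))"
        using terms rc1 rc2 ra by blast
    qed
  qed
qed

lemma hsub_comp:
  assumes "bounded_subst n1 \<theta>1 (ctx \<theta>2 \<oplus> \<Theta>)" "bounded_subst n2 \<theta>2 \<Theta>"
  shows "ctx \<theta>1 \<oplus> ctx \<theta>2 \<oplus> \<Theta> \<turnstile> M :\<^sub>a \<alpha> \<Longrightarrow>
      hsub \<theta>1 M M' \<Longrightarrow> hsub \<theta>2 M' M'' \<Longrightarrow> hsub (\<theta>2 \<circ>\<^sub>s \<theta>1) M M''"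
    "ctx \<theta>1 \<oplus> ctx \<theta>2 \<oplus> \<Theta> \<turnstile> R \<Rrightarrow> \<alpha> \<Longrightarrow>
      hsub_rc \<theta>1 R M' \<alpha> \<Longrightarrow> hsub \<theta>2 M' M'' \<Longrightarrow> hsub_rc (\<theta>2 \<circ>\<^sub>s \<theta>1) R M'' \<alpha>"
    "ctx \<theta>1 \<oplus> ctx \<theta>2 \<oplus> \<Theta> \<turnstile> R \<Rrightarrow> \<alpha> \<Longrightarrow>
      hsub_ra \<theta>1 R R' \<Longrightarrow> hsub_rc \<theta>2 R' M'' \<alpha> \<Longrightarrow> hsub_rc (\<theta>2 \<circ>\<^sub>s \<theta>1) R M'' \<alpha>"
    "ctx \<theta>1 \<oplus> ctx \<theta>2 \<oplus> \<Theta> \<turnstile> R \<Rrightarrow> \<alpha> \<Longrightarrow>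
      hsub_ra \<theta>1 R R' \<Longrightarrow> hsub_ra \<theta>2 R' R'' \<Longrightarrow> hsub_ra (\<theta>2 \<circ>\<^sub>s \<theta>1) R R''"
  using hsub_comp_uptoD[OF hsub_comp_upto assms refl] by blast+

subsection \<open>Composition on types, kinds and contexts\<close>

primrec fv_atype :: "('a, 'c) atype \<Rightarrow> var set" where
  "fv_atype (TConst a) = {}"
| "fv_atype (TApp P M) = fv_atype P \<union> fv_cterm M"

primrec fv_ctype :: "('a, 'c) ctype \<Rightarrow> var set" where
  "fv_ctype (TAtm P) = fv_atype P"
| "fv_ctype (TPi A B) = fv_ctype A \<union> fv_ctype B"

lemma finite_fv_atype [simp]: "finite (fv_atype P)"
  by (induction P) auto

lemma finite_fv_ctype [simp]: "finite (fv_ctype A)"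
  by (induction A) auto

lemma ex_close_atype:
  "lc_atype (Suc k) P \<Longrightarrow> x \<notin> fv_atype P \<Longrightarrow> \<exists>P'. P = close_atype k x P' \<and> lc_atype k P'"
proof (induction P)
  case (TConst a)
  then show ?case by (intro exI[of _ "TConst a"]) simp
next
  case (TApp P M)
  then obtain P' where P': "P = close_atype k x P'" "lc_atype k P'" by auto
  obtain M' where "M = close_cterm k x M'" "lc_cterm k M'"
    using ex_close(1)[of k M x] TApp.prems by auto
  with P' show ?case by (intro exI[of _ "TApp P' M'"]) simp
qed

lemma ex_close_ctype:
  "lc_ctype (Suc k) A \<Longrightarrow> x \<notin> fv_ctype A \<Longrightarrow> \<exists>A'. A = close_ctype k x A' \<and> lc_ctype k A'"
proof (induction A arbitrary: k)
  case (TAtm P)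
  then obtain P' where "P = close_atype k x P'" "lc_atype k P'"
    using ex_close_atype[of k P x] by auto
  then show ?case by (intro exI[of _ "TAtm P'"]) simp
next
  case (TPi A B)
  from TPi.IH(1)[of k] TPi.prems obtain A' where "A = close_ctype k x A'" "lc_ctype k A'" by auto
  moreover from TPi.IH(2)[of "Suc k"] TPi.prems obtain B' where
    "B = close_ctype (Suc k) x B'" "lc_ctype (Suc k) B'" by auto
  ultimately show ?case by (intro exI[of _ "TPi A' B'"]) simp
qed

lemma size_close_atype [simp]: "size (close_atype k x P) = size P"
  by (induction P) auto

lemma size_close_ctype [simp]: "size (close_ctype k x A) = size A"
  by (induction A arbitrary: k) auto

text \<open>The \<open>k\<close> abstractions in front account for the index at which
  \<open>x\<close> is closed, so abstracting a leaf from outside agrees with closing it inside the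
  type.\<close>

lemma lam_funpow: "lam x ((Lam ^^ k) M) = Lam ((Lam ^^ k) (close_cterm k x M))"
proof -
  have "close_cterm j x ((Lam ^^ k) M) = (Lam ^^ k) (close_cterm (j + k) x M)" for j
    by (induction k arbitrary: j) auto
  then show ?thesis by (simp add: lam_def)
qed

lemma lc_funpow_Lam [simp]: "lc_cterm j ((Lam ^^ k) M) \<longleftrightarrow> lc_cterm (j + k) M"
  by (induction k arbitrary: j) auto

text \<open>
  Abstracting every argument in a type over the binders above it reduces substitution in types,
  and respecting an arity context, to the corresponding judgements on terms.
\<close>

primrec leaves :: "nat \<Rightarrow> ('a, 'c) ctype \<Rightarrow> 'c cterm set" where
  "leaves k (TAtm P) = (Lam ^^ k) ` args P"
| "leaves k (TPi A B) = leaves k A \<union> leaves (Suc k) B"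

lemma args_close [simp]: "args (close_atype k x P) = close_cterm k x ` args P"
  by (induction P) auto

text \<open>At \<open>k = 0\<close> the leaves of \<open>tpi x A B\<close> are those of
  \<open>A\<close> together with the abstractions by \<open>lam x\<close> of those of
  \<open>B\<close>.\<close>

lemma leaves_close: "leaves (Suc k) (close_ctype k x A) = lam x ` leaves k A"
  by (induction A arbitrary: k) (auto simp: image_image image_Un lam_funpow)

lemma lc_args: "lc_atype k P \<Longrightarrow> M \<in> args P \<Longrightarrow> lc_cterm k M"
  by (induction P) auto

lemma lc_leaves: "lc_ctype k A \<Longrightarrow> M \<in> leaves k A \<Longrightarrow> lc_cterm 0 M"
  by (induction A arbitrary: k) (auto dest: lc_args)

text \<open>A leaf of the codomain is typed with \<open>x\<close> at \<open>erase A\<close>;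
  \<open>check_lam\<close> turns this into an arrow arity for its abstraction in the outer
  context.\<close>

lemma respects_type_leaves: "respects_type \<Theta> A \<Longrightarrow> M \<in> leaves 0 A \<Longrightarrow> \<exists>\<alpha>. \<Theta> \<turnstile> M :\<^sub>a \<alpha>"
proof (induction arbitrary: M rule: respects_type.induct)
  case (2 \<Theta> A x B)
  then show ?case by (auto simp: tpi_def leaves_close) (metis check_lam)
qed auto

text \<open>While \<open>leaves\<close> forgets positions, this pairs arguments at equal positions
  of types of the same shape. \<open>Q\<close> is left open so that abstraction over a name can be
  absorbed into it.\<close>

fun leafwise_atype :: "('c cterm \<Rightarrow> 'c cterm \<Rightarrow> bool) \<Rightarrow> nat \<Rightarrow> ('a, 'c) atype \<Rightarrow> ('a, 'c) atype \<Rightarrow> bool"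
  where
  "leafwise_atype Q k (TConst a) (TConst b) \<longleftrightarrow> a = b"
| "leafwise_atype Q k (TApp P M) (TApp P' M') \<longleftrightarrow>
    leafwise_atype Q k P P' \<and> Q ((Lam ^^ k) M) ((Lam ^^ k) M')"
| "leafwise_atype Q k _ _ \<longleftrightarrow> False"

fun leafwise :: "('c cterm \<Rightarrow> 'c cterm \<Rightarrow> bool) \<Rightarrow> nat \<Rightarrow> ('a, 'c) ctype \<Rightarrow> ('a, 'c) ctype \<Rightarrow> bool"
  where
  "leafwise Q k (TAtm P) (TAtm P') \<longleftrightarrow> leafwise_atype Q k P P'"
| "leafwise Q k (TPi A B) (TPi A' B') \<longleftrightarrow> leafwise Q k A A' \<and> leafwise Q (Suc k) B B'"
| "leafwise Q k _ _ \<longleftrightarrow> False"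

lemma leafwise_atype_close:
  "leafwise_atype Q (Suc k) (close_atype k x P) (close_atype k x P') \<longleftrightarrow>
    leafwise_atype (\<lambda>M M'. Q (lam x M) (lam x M')) k P P'"
proof (induction P arbitrary: P')
  case (TConst a) then show ?case by (cases P') auto
next
  case (TApp P M) then show ?case by (cases P') (auto simp: lam_funpow)
qed

lemma leafwise_close:
  "leafwise Q (Suc k) (close_ctype k x A) (close_ctype k x A') \<longleftrightarrow>
    leafwise (\<lambda>M M'. Q (lam x M) (lam x M')) k A A'"
proof (induction A arbitrary: k A')
  case (TAtm P) then show ?case by (cases A') (auto simp: leafwise_atype_close)
next
  case (TPi A B) then show ?case by (cases A') auto
qed

lemma leafwise_atype_comp:
  "leafwise_atype Q1 k P P' \<Longrightarrow> leafwise_atype Q2 k P' P'' \<Longrightarrow>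
    (\<And>M M' M''. M \<in> (Lam ^^ k) ` args P \<Longrightarrow> M'' \<in> (Lam ^^ k) ` args P'' \<Longrightarrow>
      Q1 M M' \<Longrightarrow> Q2 M' M'' \<Longrightarrow> Q3 M M'') \<Longrightarrow>
    leafwise_atype Q3 k P P''"
proof (induction Q1 k P P' arbitrary: P'' rule: leafwise_atype.induct)
  case (1 Q k a b) then show ?case by (cases P'') auto
next
  case (2 Q k P M P' M')
  show ?case
  proof (cases P'')
    case (TApp R N)
    have "leafwise_atype Q3 k P R"
      using 2(2,3) TApp by (intro 2(1)) (auto intro: 2(4))
    moreover have "Q3 ((Lam ^^ k) M) ((Lam ^^ k) N)"
      using 2(2,3) TApp by (intro 2(4)[of _ _ "(Lam ^^ k) M'"]) auto
    ultimately show ?thesis using TApp by simp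
  qed (use 2 in auto)
qed auto

text \<open>\<open>Q3\<close> is required only between leaves of the outer types, so that their
  arity typing or local closedness can be used.\<close>

lemma leafwise_comp:
  "leafwise Q1 k A A' \<Longrightarrow> leafwise Q2 k A' A'' \<Longrightarrow>
    (\<And>M M' M''. M \<in> leaves k A \<Longrightarrow> M'' \<in> leaves k A'' \<Longrightarrow> Q1 M M' \<Longrightarrow> Q2 M' M'' \<Longrightarrow> Q3 M M'') \<Longrightarrow>
    leafwise Q3 k A A''"
proof (induction Q1 k A A' arbitrary: A'' rule: leafwise.induct)
  case (1 Q k P P')
  show ?case
  proof (cases A'')
    case (TAtm R)
    have "leafwise_atype Q3 k P R"
      using 1(1,2) TAtm by (intro leafwise_atype_comp[of Q k P P' Q2 R]) (auto intro: 1(3))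
    then show ?thesis using TAtm by simp
  qed (use 1 in auto)
next
  case (2 Q k A B A' B')
  show ?case
  proof (cases A'')
    case (TPi C D)
    have "leafwise Q3 k A C"
      using 2(3,4) TPi by (intro 2(1)) (auto intro: 2(5))
    moreover have "leafwise Q3 (Suc k) B D"
      using 2(3,4) TPi by (intro 2(2)) (auto intro: 2(5))
    ultimately show ?thesis using TPi by simp
  qed (use 2 in auto)
qed auto

lemma leafwise_atype_refl: "leafwise_atype (=) k P P"
  by (induction P) auto

lemma leafwise_refl: "leafwise (=) k A A"
  by (induction A arbitrary: k) (auto simp: leafwise_atype_refl)

text \<open>Composition with equality as second relation.\<close>

lemma leafwise_mono:
  assumes "leafwise Q k A A'"
    and "\<And>M M'. M \<in> leaves k A \<Longrightarrow> M' \<in> leaves k A' \<Longrightarrow> Q M M' \<Longrightarrow> Q' M M'"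
  shows "leafwise Q' k A A'"
  by (rule leafwise_comp[OF assms(1) leafwise_refl]) (use assms(2) in auto)

lemma hsub_atype_leafwise: "hsub_atype \<theta> P P' \<longleftrightarrow> leafwise_atype (hsub \<theta>) 0 P P'"
proof
  show "hsub_atype \<theta> P P' \<Longrightarrow> leafwise_atype (hsub \<theta>) 0 P P'"
    by (induction rule: hsub_atype.induct) auto
  show "leafwise_atype (hsub \<theta>) 0 P P' \<Longrightarrow> hsub_atype \<theta> P P'"
    by (induction "hsub \<theta>" "0 :: nat" P P' rule: leafwise_atype.induct)
      (auto intro: hsub_atype.intros)
qed

lemma hsub_type_leafwise: "hsub_type \<theta> A A' \<Longrightarrow> leafwise (hsub \<theta>) 0 A A'"
proof (induction rule: hsub_type.induct)
  case (1 \<theta> P P')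
  then show ?case by (simp add: hsub_atype_leafwise)
next
  case (2 x \<theta> A A' B B')
  have "leafwise (\<lambda>M M'. hsub \<theta> (lam x M) (lam x M')) 0 B B'"
    using 2 by (blast intro: leafwise_mono hsub_lam)
  then show ?case using 2 by (simp add: tpi_def leafwise_close)
qed

section \<open>Recovering substitution in types from the leaves\<close>

definition closed_subst :: "'c subst \<Rightarrow> bool" where
  "closed_subst \<theta> \<longleftrightarrow> (\<forall>(x, N, \<beta>) \<in> \<theta>. lc_cterm 0 N)"

text \<open>Inversion presents the result as \<open>lam x N\<close> for some \<open>N\<close>. As
  \<theta> is closed, \<open>N\<close> is locally closed, and abstracting one and the same name is
  injective on such bodies.\<close>

lemma hsub_lam_sameD:
  assumes "hsub \<theta> (lam x M) (lam x M')" "fresh_for x \<theta>" "finite \<theta>" "closed_subst \<theta>"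
    "lc_cterm 0 M" "lc_cterm 0 M'"
  shows "hsub \<theta> M M'"
proof -
  obtain N where N: "lam x M' = lam x N" "hsub \<theta> M N"
    using hsub_lamD[OF assms(1,2,3,5)] by metis
  have "lc_cterm 0 N" using lc_hsub(1)[OF N(2)] assms(4) by (simp add: closed_subst_def)
  then have "M' = ren_cterm (id(x := x)) N" using lam_eqD[OF N(1) assms(6)] by simp
  also have "id(x := x) = id" by auto
  finally have "M' = N" by (simp only: ren_id)
  with N(2) show ?thesis by simp
qed

text \<open>The induction is on \<open>size\<close> since a codomain is opened before the hypothesis
  applies. One fresh name opens both codomains, and \<open>hsub_lam_sameD\<close> strips it from
  every leaf.\<close>

lemma leafwise_hsub_type:
  assumes "finite \<theta>" "closed_subst \<theta>"
  shows "lc_ctype 0 A \<Longrightarrow> lc_ctype 0 A' \<Longrightarrow> leafwise (hsub \<theta>) 0 A A' \<Longrightarrow> hsub_type \<theta> A A'"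
proof (induction "size A" arbitrary: A A' rule: less_induct)
  case less
  show ?case
  proof (cases A)
    case (TAtm P)
    then show ?thesis using less.prems(3)
      by (cases A') (auto simp: hsub_atype_leafwise[symmetric] intro: hsub_type.intros)
  next
    case (TPi B C)
    then obtain B' C' where A': "A' = TPi B' C'" using less.prems(3) by (cases A') auto
    let ?F = "supp \<theta> \<union> fv_ctype C \<union> fv_ctype C'"
    obtain x where x: "x \<notin> ?F" using ex_fresh[of ?F] assms(1) by auto
    then have fr: "fresh_for x \<theta>" by (simp add: fresh_for_iff)
    obtain D where D: "C = close_ctype 0 x D" "lc_ctype 0 D"
      using ex_close_ctype[of 0 C x] less.prems(1) TPi x by auto
    obtain D' where D': "C' = close_ctype 0 x D'" "lc_ctype 0 D'"
      using ex_close_ctype[of 0 C' x] less.prems(2) A' x by auto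
    have "leafwise (\<lambda>M M'. hsub \<theta> (lam x M) (lam x M')) 0 D D'"
      using less.prems(3) TPi A' D D' by (simp add: leafwise_close)
    then have "leafwise (hsub \<theta>) 0 D D'"
      using hsub_lam_sameD[OF _ fr assms] lc_leaves[OF D(2)] lc_leaves[OF D'(2)]
      by (blast intro: leafwise_mono)
    then have "hsub_type \<theta> D D'" using D D' TPi by (intro less.hyps) auto
    moreover have "hsub_type \<theta> B B'" using less.prems TPi A' by (intro less.hyps) auto
    ultimately have "hsub_type \<theta> (tpi x B D) (tpi x B' D')" using fr by (intro hsub_type.intros)
    then show ?thesis using TPi A' D D' by (simp add: tpi_def)
  qed
qed

lemma lc_hsub_atype: "hsub_atype \<theta> P P' \<Longrightarrow> closed_subst \<theta> \<Longrightarrow> lc_atype 0 P \<and> lc_atype 0 P'"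
  by (induction rule: hsub_atype.induct) (auto simp: closed_subst_def dest: lc_hsub(1))

lemma lc_hsub_type: "hsub_type \<theta> A A' \<Longrightarrow> closed_subst \<theta> \<Longrightarrow> lc_ctype 0 A \<and> lc_ctype 0 A'"
  by (induction rule: hsub_type.induct) (auto simp: tpi_def lc_close_ctype dest: lc_hsub_atype)

lemma bounded_subst_closed: "bounded_subst n \<theta> \<Theta> \<Longrightarrow> closed_subst \<theta>"
  by (auto simp: closed_subst_def dest: bounded_substD(4) lc_arity_typing(2))

lemma closed_comp_subst: "closed_subst \<theta>1 \<Longrightarrow> closed_subst \<theta>2 \<Longrightarrow> closed_subst (\<theta>2 \<circ>\<^sub>s \<theta>1)"
  by (fastforce simp: closed_subst_def comp_subst_def dest: lc_hsub(1))

text \<open>Lets \<open>leafwise_hsub_type\<close> choose names fresh for the composition. By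
  determinism a triple of \<theta>1 has at most one image.\<close>

lemma finite_comp_subst:
  assumes "substitution \<theta>1" "substitution \<theta>2"
  shows "finite (\<theta>2 \<circ>\<^sub>s \<theta>1)"
proof -
  have "finite {M'. hsub \<theta>2 M M'}" for M
  proof -
    \<comment> \<open>\<open>THE\<close> names the unique result if there is one; if there is none,
      the left side is empty.\<close>
    have "{M'. hsub \<theta>2 M M'} \<subseteq> {THE M'. hsub \<theta>2 M M'}"
      using hsub_det(1)[OF _ assms(2)] by (auto intro: the_equality[symmetric])
    then show ?thesis by (rule finite_subset) simp
  qed
  then have "finite ((\<Union>(x, M, \<alpha>) \<in> \<theta>1. (\<lambda>M'. (x, M', \<alpha>)) ` {M'. hsub \<theta>2 M M'}) \<union> \<theta>2)"
    using assms by (auto simp: substitution_def)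
  then show ?thesis by (rule rev_finite_subset) (auto simp: comp_subst_def)
qed

lemma hsub_type_comp:
  assumes bd: "bounded_subst n1 \<theta>1 (ctx \<theta>2 \<oplus> \<Theta>)" "bounded_subst n2 \<theta>2 \<Theta>"
    and A: "respects_type (ctx \<theta>1 \<oplus> ctx \<theta>2 \<oplus> \<Theta>) A"
    and A': "hsub_type \<theta>1 A A'" and A'': "hsub_type \<theta>2 A' A''"
  shows "hsub_type (\<theta>2 \<circ>\<^sub>s \<theta>1) A A''"
proof (rule leafwise_hsub_type)
  show "finite (\<theta>2 \<circ>\<^sub>s \<theta>1)"
    using finite_comp_subst bounded_substD(1)[OF bd(1)] bounded_substD(1)[OF bd(2)] .
  show "closed_subst (\<theta>2 \<circ>\<^sub>s \<theta>1)"
    using bd by (intro closed_comp_subst bounded_subst_closed)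
  show "lc_ctype 0 A" using A by (rule lc_respects_type)
  show "lc_ctype 0 A''" using lc_hsub_type[OF A'' bounded_subst_closed[OF bd(2)]] by simp
  show "leafwise (hsub (\<theta>2 \<circ>\<^sub>s \<theta>1)) 0 A A''"
    using hsub_type_leafwise[OF A'] hsub_type_leafwise[OF A'']
  proof (rule leafwise_comp)
    fix M M' M'' assume "M \<in> leaves 0 A" "hsub \<theta>1 M M'" "hsub \<theta>2 M' M''"
    then show "hsub (\<theta>2 \<circ>\<^sub>s \<theta>1) M M''"
      using respects_type_leaves[OF A] hsub_comp(1)[OF bd] by blast
  qed
qed

text \<open>
  With some type constant in the place of \<open>Type\<close>, kinds behave like types, so nothing has to be
  repeated for them.
\<close>

primrec type_of_kind :: "('a, 'c) kind \<Rightarrow> ('a, 'c) ctype" where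
  "type_of_kind KType = TAtm (TConst undefined)"
| "type_of_kind (KPi A K) = TPi A (type_of_kind K)"

lemma type_of_kind_close: "type_of_kind (close_kind k x K) = close_ctype k x (type_of_kind K)"
  by (induction K arbitrary: k) auto

lemma type_of_kpi: "type_of_kind (kpi x A K) = tpi x A (type_of_kind K)"
  by (simp add: kpi_def tpi_def type_of_kind_close)

text \<open>Closing keeps all constructors of a type, so the encoding of kinds can be undone below a
  binder; the converse in \<open>hsub_type_of_kind\<close> rests on this.\<close>

lemma type_of_kind_eq_close:
  "type_of_kind K = close_ctype k x B \<Longrightarrow> \<exists>K'. B = type_of_kind K' \<and> K = close_kind k x K'"
proof (induction K arbitrary: k B)
  case KType
  then obtain P where P: "B = TAtm P" by (cases B) auto
  then have "P = TConst undefined" using KType by (cases P) auto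
  then show ?case using P by (intro exI[of _ KType]) simp
next
  case (KPi A K)
  then obtain C D where B: "B = TPi C D" by (cases B) auto
  then obtain K' where "D = type_of_kind K'" "K = close_kind (Suc k) x K'"
    using KPi by (metis close_ctype.simps(2) ctype.inject(2) type_of_kind.simps(2))
  then show ?case using B KPi.prems by (intro exI[of _ "KPi C K'"]) simp
qed

lemma type_of_kind_eq_tpi:
  assumes "type_of_kind K = tpi x A B"
  obtains K' where "B = type_of_kind K'" "K = kpi x A K'"
proof (cases K)
  case KType
  then show ?thesis using assms by (simp add: tpi_def)
next
  case (KPi C L)
  then have "C = A" "type_of_kind L = close_ctype 0 x B" using assms by (auto simp: tpi_def)
  then show ?thesis using type_of_kind_eq_close[of L 0 x B] KPi that by (auto simp: kpi_def)
qed

lemma respects_type_of_kind: "respects_kind \<Theta> K \<Longrightarrow> respects_type \<Theta> (type_of_kind K)"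
  by (induction rule: respects_kind.induct) (auto simp: type_of_kpi intro!: respects_type.intros)

lemma hsub_type_of_kind: "hsub_type \<theta> (type_of_kind K) (type_of_kind K') \<longleftrightarrow> hsub_kind \<theta> K K'"
proof
  show "hsub_kind \<theta> K K' \<Longrightarrow> hsub_type \<theta> (type_of_kind K) (type_of_kind K')"
    by (induction rule: hsub_kind.induct)
      (auto simp: type_of_kpi intro!: hsub_type.intros hsub_atype.intros)
  show "hsub_type \<theta> (type_of_kind K) (type_of_kind K') \<Longrightarrow> hsub_kind \<theta> K K'"
  proof (induction \<theta> "type_of_kind K" "type_of_kind K'" arbitrary: K K' rule: hsub_type.induct)
    case (1 \<theta> P P')
    then have "K = KType" "K' = KType" by (cases K; cases K'; simp)+
    then show ?case by (simp add: hsub_kind.intros)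
  next
    case (2 x \<theta> A A' B B')
    obtain L where L: "B = type_of_kind L" "K = kpi x A L"
      using 2(6) type_of_kind_eq_tpi by metis
    obtain L' where L': "B' = type_of_kind L'" "K' = kpi x A' L'"
      using 2(7) type_of_kind_eq_tpi by metis
    have "hsub_kind \<theta> L L'" using 2 L L' by blast
    then show ?case using 2 L L' by (auto intro: hsub_kind.intros)
  qed
qed

text \<open>Declared variables keep their names and all types respect the same arity context, so
  each declaration is handled separately by \<open>hsub_type_comp\<close>.\<close>

lemma hsub_ctx_comp:
  assumes bd: "bounded_subst n1 \<theta>1 (ctx \<theta>2 \<oplus> \<Theta>)" "bounded_subst n2 \<theta>2 \<Theta>"
  shows "respects_ctx (ctx \<theta>1 \<oplus> ctx \<theta>2 \<oplus> \<Theta>) \<Gamma> \<Longrightarrow> hsub_ctx \<theta>1 \<Gamma> \<Gamma>' \<Longrightarrow> hsub_ctx \<theta>2 \<Gamma>' \<Gamma>'' \<Longrightarrow>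
    hsub_ctx (\<theta>2 \<circ>\<^sub>s \<theta>1) \<Gamma> \<Gamma>''"
proof (induction \<Gamma> arbitrary: \<Gamma>' \<Gamma>'')
  case Empty
  then show ?case by (auto elim!: hsub_ctx.cases intro: hsub_ctx.intros)
next
  case (Extend \<Gamma> x A)
  from Extend.prems(2) obtain \<Delta> A' where 1: "\<Gamma>' = Extend \<Delta> x A'" "fresh_for x \<theta>1"
    "hsub_ctx \<theta>1 \<Gamma> \<Delta>" "hsub_type \<theta>1 A A'" by (cases rule: hsub_ctx.cases) auto
  from Extend.prems(3)[unfolded 1(1)] obtain \<Delta>' A'' where 2: "\<Gamma>'' = Extend \<Delta>' x A''"
    "fresh_for x \<theta>2" "hsub_ctx \<theta>2 \<Delta> \<Delta>'" "hsub_type \<theta>2 A' A''" by (cases rule: hsub_ctx.cases) auto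
  have "hsub_type (\<theta>2 \<circ>\<^sub>s \<theta>1) A A''"
    using hsub_type_comp[OF bd _ 1(4) 2(4)] Extend.prems(1) by simp
  moreover have "hsub_ctx (\<theta>2 \<circ>\<^sub>s \<theta>1) \<Gamma> \<Delta>'"
    using Extend.IH[OF _ 1(3) 2(3)] Extend.prems(1) by simp
  ultimately show ?case
    unfolding 2(1) using fresh_for_comp[OF 1(2) 2(2)] by (intro hsub_ctx.intros)
qed

theorem theorem2p10:
  fixes \<theta>1 \<theta>2 :: "'c subst" and \<Theta> \<Theta>' :: "'c actx"
  assumes "substitution \<theta>1" and "substitution \<theta>2" and "arity_context \<Theta>"
    and "arity_compatible \<theta>1 \<theta>2 \<Theta>"
    and "\<Theta>' = ctx (\<theta>2 \<circ>\<^sub>s \<theta>1) \<oplus> \<Theta>"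
  shows
    "(\<forall>K K' K'' :: ('a, 'c) kind. respects_kind \<Theta>' K \<longrightarrow>
        hsub_kind \<theta>1 K K' \<longrightarrow> hsub_kind \<theta>2 K' K'' \<longrightarrow> hsub_kind (\<theta>2 \<circ>\<^sub>s \<theta>1) K K'') \<and>
     (\<forall>A A' A'' :: ('a, 'c) ctype. respects_type \<Theta>' A \<longrightarrow>
        hsub_type \<theta>1 A A' \<longrightarrow> hsub_type \<theta>2 A' A'' \<longrightarrow> hsub_type (\<theta>2 \<circ>\<^sub>s \<theta>1) A A'') \<and>
     (\<forall>\<Gamma> \<Gamma>' \<Gamma>'' :: ('a, 'c) lfctx. respects_ctx \<Theta>' \<Gamma> \<longrightarrow>
        hsub_ctx \<theta>1 \<Gamma> \<Gamma>' \<longrightarrow> hsub_ctx \<theta>2 \<Gamma>' \<Gamma>'' \<longrightarrow> hsub_ctx (\<theta>2 \<circ>\<^sub>s \<theta>1) \<Gamma> \<Gamma>'') \<and>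
     (\<forall>M M' M''. (\<exists>\<alpha>. \<Theta>' \<turnstile> M :\<^sub>a \<alpha>) \<longrightarrow>
        hsub \<theta>1 M M' \<longrightarrow> hsub \<theta>2 M' M'' \<longrightarrow> hsub (\<theta>2 \<circ>\<^sub>s \<theta>1) M M'') \<and>
     (\<forall>R \<alpha>. \<Theta>' \<turnstile> R \<Rrightarrow> \<alpha> \<longrightarrow>
        (\<forall>M' M''. hsub_rc \<theta>1 R M' \<alpha> \<longrightarrow> hsub \<theta>2 M' M'' \<longrightarrow> hsub_rc (\<theta>2 \<circ>\<^sub>s \<theta>1) R M'' \<alpha>) \<and>
        (\<forall>R' M''. hsub_ra \<theta>1 R R' \<longrightarrow> hsub_rc \<theta>2 R' M'' \<alpha> \<longrightarrow> hsub_rc (\<theta>2 \<circ>\<^sub>s \<theta>1) R M'' \<alpha>) \<and>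
        (\<forall>R' R''. hsub_ra \<theta>1 R R' \<longrightarrow> hsub_ra \<theta>2 R' R'' \<longrightarrow> hsub_ra (\<theta>2 \<circ>\<^sub>s \<theta>1) R R''))"
proof -
  obtain n1 n2 where bd: "bounded_subst n1 \<theta>1 (ctx \<theta>2 \<oplus> \<Theta>)" "bounded_subst n2 \<theta>2 \<Theta>"
    using ex_bounded_subst assms(1,2,4) unfolding arity_compatible_def by metis
  \<comment> \<open>Splitting the context of the composition gives the form in which the preceding
    results are stated.\<close>
  have \<Theta>': "\<Theta>' = ctx \<theta>1 \<oplus> ctx \<theta>2 \<oplus> \<Theta>" using ctx_comp_subst[OF bd] assms(5) by simp
  note types = hsub_type_comp[OF bd, folded \<Theta>']
  have kinds: "hsub_kind (\<theta>2 \<circ>\<^sub>s \<theta>1) K K''"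
    if "respects_kind \<Theta>' K" "hsub_kind \<theta>1 K K'" "hsub_kind \<theta>2 K' K''"
    for K K' K'' :: "('a, 'c) kind"
    using types that unfolding hsub_type_of_kind[symmetric] by (blast dest: respects_type_of_kind)
  show ?thesis
    by (intro conjI allI impI;
        blast intro: kinds types hsub_ctx_comp[OF bd, folded \<Theta>'] hsub_comp[OF bd, folded \<Theta>'])
qed

end
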